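(* In the class of complemented $\sigma$-subalgebras of $\Lambda$, the universal $\sigma$-subalgebras are exactly the finite partitions and the independent complements of finite partitions.
   Context: $I=(0,1]$ with the Lebesgue $\sigma$-algebra $\Lambda$ and Lebesgue measure $\lambda$. For $f\in L^1(I)$, $f^*$ is the non-increasing right-continuous function on $I$ equimeasurable with $|f|$. A $\sigma$-subalgebra is a sub-$\sigma$-algebra of $\Lambda$ containing all null sets. A finite partition is the $\sigma$-subalgebra generated by finitely many pairwise disjoint sets of positive measure with union $I$ (mod null sets). $\mathcal{A}$ is complemented if it has an independent complement, i.e. a $\sigma$-subalgebra $\mathcal{A}^\perp$ with $\sigma(\mathcal{A}\cup\mathcal{A}^\perp)=\Lambda$ and $\lambda(D\cap E)=\lambda(D)\lambda(E)$ for $D\in\mathcal{A}$, $E\in\mathcal{A}^\perp$. A symmetric ideal is a vector space $X$, $L^\infty(I)\subseteq X\subseteq L^1(I)$, such that $x\in X$, $|y|\le|x|$ imply $y\in X$, and $x\in X$, $y\in L^1(I)$, $y^*\le x^*$ imply $y\in X$. $\mathcal{A}$ averages $X$ if $E(X|\mathcal{A})\subseteq X$, where $E(\cdot|\mathcal{A})$ is conditional expectation. $\mathcal{A}$ is universal if it averages every symmetric ideal $X\subseteq L^1(I)$. *)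

theory Defs
  imports "HOL-Probability.Probability"
begin

abbreviation I :: "real set" where "I \<equiv> {0<..1}"

abbreviation leb_I :: "real measure" where "leb_I \<equiv> lebesgue_on I"

section \<open>Decreasing rearrangements\<close>

text \<open>A non-increasing right-continuous function on \<open>I\<close> equimeasurable with \<open>|f|\<close>. These
  conditions do not determine the value at the right end point \<open>1\<close>, which is irrelevant
  because functions on \<open>I\<close> are only compared almost everywhere.\<close>

definition is_rearrangement :: "(real \<Rightarrow> real) \<Rightarrow> (real \<Rightarrow> real) \<Rightarrow> bool" where
  "is_rearrangement f g \<longleftrightarrow>
     antimono_on I g \<and>
     (\<forall>t\<in>I. continuous (at t within {t..1}) g) \<and>
     (\<forall>s. measure leb_I {t\<in>I. \<bar>f t\<bar> > s} = measure leb_I {t\<in>I. g t > s})"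

definition rearrangement :: "(real \<Rightarrow> real) \<Rightarrow> real \<Rightarrow> real" where
  "rearrangement f = (SOME g. is_rearrangement f g)"

interpretation leb_I: prob_space leb_I
  by (rule prob_spaceI) (simp add: emeasure_restrict_space)

lemma measure_leb_I_interval:
  assumes "0 \<le> a" "a \<le> 1"
  shows "measure leb_I {0<..a} = a" "measure leb_I {0<..<a} = a"
  using assms by (auto simp: measure_restrict_space subset_eq)

lemma sets_antimono_superlevel:
  assumes "antimono_on I (g :: real \<Rightarrow> real)"
  shows "{t\<in>I. g t > s} \<in> sets leb_I"
proof -
  have "is_interval {t\<in>I. g t > s}"
    unfolding is_interval_1
    using assms by (force simp: monotone_on_def)
  then have "{t\<in>I. g t > s} \<in> sets lebesgue"
    by (intro sets_completionI_sets) (simp add: real_interval_borel_measurable)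
  then show ?thesis by (auto simp: sets_restrict_space_iff)
qed

text \<open>The distribution function and its generalised inverse give a rearrangement.\<close>

lemma is_rearrangement_exists:
  assumes [measurable]: "f \<in> borel_measurable leb_I"
  shows "\<exists>g. is_rearrangement f g"
proof -
  define d where "d s = measure leb_I {t\<in>I. \<bar>f t\<bar> > s}" for s
  have S [measurable]: "{t\<in>I. \<bar>f t\<bar> > s} \<in> sets leb_I" for s
  proof -
    have "{t\<in>space leb_I. \<bar>f t\<bar> > s} \<in> sets leb_I" by measurable
    then show ?thesis by simp
  qed
  have d01: "0 \<le> d s" "d s \<le> 1" for s
    by (auto simp: d_def)
  have danti: "d s' \<le> d s" if "s \<le> s'" for s s'
    unfolding d_def by (rule leb_I.finite_measure_mono) (use that S in auto)
  have d_rc: "(\<lambda>n. d (s + 1 / real (Suc n))) \<longlonglongrightarrow> d s" for s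
  proof -
    have U: "(\<Union>n. {t\<in>I. \<bar>f t\<bar> > s + 1 / real (Suc n)}) = {t\<in>I. \<bar>f t\<bar> > s}"
    proof (intro equalityI subsetI)
      fix t assume "t \<in> {t\<in>I. \<bar>f t\<bar> > s}"
      then have t: "t \<in> I" "\<bar>f t\<bar> - s > 0" by auto
      then obtain n where "1 / real (Suc n) < \<bar>f t\<bar> - s" using nat_approx_posE by blast
      then show "t \<in> (\<Union>n. {t\<in>I. \<bar>f t\<bar> > s + 1 / real (Suc n)})"
        using t by (intro UN_I[of n]) (auto simp del: of_nat_Suc)
    next
      fix t assume "t \<in> (\<Union>n. {t\<in>I. \<bar>f t\<bar> > s + 1 / real (Suc n)})"
      then obtain n where n: "t \<in> I" "\<bar>f t\<bar> > s + 1 / real (Suc n)" by blast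
      have "1 / real (Suc n) > 0" by simp
      with n(2) have "\<bar>f t\<bar> > s" by linarith
      with n(1) show "t \<in> {t\<in>I. \<bar>f t\<bar> > s}" by blast
    qed
    have "incseq (\<lambda>n. {t\<in>I. \<bar>f t\<bar> > s + 1 / real (Suc n)})"
    proof (rule incseq_SucI, rule subsetI)
      fix n t assume "t \<in> {t\<in>I. \<bar>f t\<bar> > s + 1 / real (Suc n)}"
      moreover have "1 / real (Suc (Suc n)) \<le> 1 / real (Suc n)" by (simp add: field_simps)
      ultimately show "t \<in> {t\<in>I. \<bar>f t\<bar> > s + 1 / real (Suc (Suc n))}" by auto
    qed
    then have "(\<lambda>n. measure leb_I {t\<in>I. \<bar>f t\<bar> > s + 1 / real (Suc n)}) \<longlonglongrightarrow>
        measure leb_I (\<Union>n. {t\<in>I. \<bar>f t\<bar> > s + 1 / real (Suc n)})"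
      by (intro leb_I.finite_Lim_measure_incseq) (use S in auto)
    then show ?thesis unfolding U d_def .
  qed
  have d0: "\<exists>s\<ge>0. d s < e" if "e > 0" for e
  proof -
    have E: "(\<Inter>n. {t\<in>I. \<bar>f t\<bar> > real n}) = {}"
    proof -
      have "t \<notin> (\<Inter>n. {t\<in>I. \<bar>f t\<bar> > real n})" for t
      proof -
        obtain n where "\<bar>f t\<bar> \<le> real n" using real_arch_simple by blast
        then have "t \<notin> {t\<in>I. \<bar>f t\<bar> > real n}" by simp
        then show ?thesis by blast
      qed
      then show ?thesis by (simp only: set_eq_iff empty_iff simp_thms)
    qed
    have "(\<lambda>n. measure leb_I {t\<in>I. \<bar>f t\<bar> > real n}) \<longlonglongrightarrow>
        measure leb_I (\<Inter>n. {t\<in>I. \<bar>f t\<bar> > real n})"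
    proof (rule leb_I.finite_Lim_measure_decseq)
      show "range (\<lambda>n. {t\<in>I. \<bar>f t\<bar> > real n}) \<subseteq> sets leb_I" using S by auto
      show "decseq (\<lambda>n. {t\<in>I. \<bar>f t\<bar> > real n})" by (rule decseq_SucI) auto
    qed
    then have "(\<lambda>n. d (real n)) \<longlonglongrightarrow> 0" unfolding E d_def by simp
    then have "\<forall>\<^sub>F n in sequentially. d (real n) < e"
      by (rule order_tendstoD) (rule that)
    then obtain n where "d (real n) < e" by (auto simp: eventually_sequentially)
    then show ?thesis by (intro exI[of _ "real n"]) auto
  qed
  define g where "g t = Inf {s. 0 \<le> s \<and> d s \<le> t}" for t
  have ne: "{s. 0 \<le> s \<and> d s \<le> t} \<noteq> {}" if "t > 0" for t
    using d0[OF that] by force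
  have bb: "bdd_below {s. 0 \<le> s \<and> d s \<le> t}" for t by (rule bdd_belowI[of _ 0]) auto
  have g0: "g t \<ge> 0" if "t > 0" for t
    unfolding g_def by (rule cInf_greatest) (use ne[OF that] in auto)
  have g_iff: "s < g t \<longleftrightarrow> t < d s" if "t > 0" "s \<ge> 0" for s t
  proof
    assume "s < g t"
    show "t < d s"
    proof (rule ccontr)
      assume "\<not> t < d s"
      then have "g t \<le> s" unfolding g_def by (intro cInf_lower bb) (use that in auto)
      with \<open>s < g t\<close> show False by simp
    qed
  next
    assume lt: "t < d s"
    have "\<forall>\<^sub>F n in sequentially. t < d (s + 1 / real (Suc n))"
      by (rule order_tendstoD(1)[OF d_rc lt])
    then obtain n where n: "t < d (s + 1 / real (Suc n))" by (auto simp: eventually_sequentially)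
    have "s + 1 / real (Suc n) \<le> g t"
      unfolding g_def
    proof (rule cInf_greatest)
      fix r assume r: "r \<in> {s. 0 \<le> s \<and> d s \<le> t}"
      show "s + 1 / real (Suc n) \<le> r"
        using n r danti[of r "s + 1 / real (Suc n)"] by (cases "s + 1 / real (Suc n) \<le> r") auto
    qed (use ne that in blast)
    moreover have "1 / real (Suc n) > 0" by simp
    ultimately show "s < g t" by linarith
  qed
  have ganti: "g t' \<le> g t" if "t > 0" "t \<le> t'" for t t'
    unfolding g_def by (rule cInf_superset_mono) (use ne[OF that(1)] bb that in auto)
  have "is_rearrangement f g"
    unfolding is_rearrangement_def
  proof (intro conjI ballI allI)
    show "antimono_on I g" using ganti by (auto simp: monotone_on_def)
  next
    fix t :: real assume t: "t \<in> I"
    show "continuous (at t within {t..1}) g"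
      unfolding continuous_within
    proof (rule order_tendstoI)
      fix a assume a: "a < g t"
      show "\<forall>\<^sub>F x in at t within {t..1}. a < g x"
      proof (cases "a < 0")
        case True
        then have "a < g x" if "x \<in> {t..1}" for x using g0[of x] t that by force
        then show ?thesis by (auto simp: eventually_at_filter)
      next
        case False
        then have "t < d a" using g_iff[of t a] a t by auto
        then have "\<forall>\<^sub>F x in at t within {t..1}. x < d a"
          by (intro order_tendstoD(2)[OF tendsto_ident_at])
        moreover have "\<forall>\<^sub>F x in at t within {t..1}. x \<in> {t..1}"
          by (auto simp: eventually_at_filter)
        ultimately show ?thesis
          by eventually_elim (use g_iff False t in auto)
      qed
    next
      fix a assume a: "g t < a"
      have "g x < a" if "x \<in> {t..1}" for x using ganti[of t x] t that a by force
      then show "\<forall>\<^sub>F x in at t within {t..1}. g x < a" by (auto simp: eventually_at_filter)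
    qed
  next
    fix s
    show "measure leb_I {t\<in>I. \<bar>f t\<bar> > s} = measure leb_I {t\<in>I. g t > s}"
    proof (cases "s < 0")
      case True
      have "{t\<in>I. g t > s} = I" using g0 True by force
      moreover have "{t\<in>I. \<bar>f t\<bar> > s} = I" using True by force
      ultimately show ?thesis by simp
    next
      case False
      have "{t\<in>I. g t > s} = {0<..<d s}" using g_iff False d01(2)[of s] by force
      then show ?thesis using measure_leb_I_interval(2)[OF d01] by (simp add: d_def)
    qed
  qed
  then show ?thesis by blast
qed

lemma is_rearrangement_rearrangement:
  assumes "f \<in> borel_measurable leb_I"
  shows "is_rearrangement f (rearrangement f)"
  unfolding rearrangement_def using is_rearrangement_exists[OF assms] by (rule someI_ex)

lemma is_rearrangement_le:
  assumes g: "is_rearrangement f g" and h: "is_rearrangement f h" and t: "t \<in> {0<..<1}"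
  shows "g t \<le> h t"
proof (rule ccontr)
  assume "\<not> g t \<le> h t"
  then obtain s where s: "h t < s" "s < g t" using dense by (metis not_le)
  have "(g \<longlongrightarrow> g t) (at t within {t..1})"
    using g t by (auto simp: is_rearrangement_def continuous_within)
  then have "\<forall>\<^sub>F x in at t within {t..1}. s < g x" by (rule order_tendstoD) (rule s)
  then obtain e where e: "e > 0" "\<And>x. x \<in> {t..1} \<Longrightarrow> x \<noteq> t \<Longrightarrow> dist x t < e \<Longrightarrow> s < g x"
    unfolding eventually_at by auto
  define u where "u = min 1 (t + e / 2)"
  have u: "t < u" "u \<le> 1" "s < g u"
    using e(1) t e(2)[of u] by (auto simp: u_def dist_real_def)
  have ag: "antimono_on I g" and ah: "antimono_on I h"
    using g h by (auto simp: is_rearrangement_def)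
  have "{0<..u} \<subseteq> {t\<in>I. g t > s}"
  proof
    fix x assume x: "x \<in> {0<..u}"
    have "g u \<le> g x" using ag x u t by (auto simp: monotone_on_def)
    then show "x \<in> {t\<in>I. g t > s}" using x u by auto
  qed
  then have "measure leb_I {0<..u} \<le> measure leb_I {t\<in>I. g t > s}"
    by (intro leb_I.finite_measure_mono sets_antimono_superlevel ag)
  moreover have "{t\<in>I. h t > s} \<subseteq> {0<..t}"
  proof
    fix x assume x: "x \<in> {t\<in>I. h t > s}"
    show "x \<in> {0<..t}"
    proof (rule ccontr)
      assume "x \<notin> {0<..t}"
      then have "h x \<le> h t" using ah x t by (auto simp: monotone_on_def)
      then show False using s x by auto
    qed
  qed
  then have "measure leb_I {t\<in>I. h t > s} \<le> measure leb_I {0<..t}"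
    by (intro leb_I.finite_measure_mono) (use t in \<open>auto simp: sets_restrict_space_iff\<close>)
  ultimately show False
    using g h u t by (auto simp: is_rearrangement_def measure_leb_I_interval)
qed

lemma is_rearrangement_unique:
  assumes "is_rearrangement f g" "is_rearrangement f h" "t \<in> {0<..<1}"
  shows "g t = h t"
  using is_rearrangement_le assms by (metis order_antisym)

section \<open>Symmetric ideals\<close>

text \<open>Spaces of classes of functions modulo equality almost everywhere are represented by sets of
  functions \<open>real \<Rightarrow> real\<close>. The ideal property, required for the almost everywhere order,
  makes such a set closed under changes on null sets and outside \<open>I\<close>.\<close>

definition L1 :: "(real \<Rightarrow> real) set" where
  "L1 = {f. integrable leb_I f}"

definition Linf :: "(real \<Rightarrow> real) set" where
  "Linf = {f \<in> borel_measurable leb_I. \<exists>C. AE t in leb_I. \<bar>f t\<bar> \<le> C}"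

definition symmetric_ideal :: "(real \<Rightarrow> real) set \<Rightarrow> bool" where
  "symmetric_ideal X \<longleftrightarrow>
     Linf \<subseteq> X \<and> X \<subseteq> L1 \<and>
     (\<forall>x\<in>X. \<forall>y\<in>X. (\<lambda>t. x t + y t) \<in> X) \<and>
     (\<forall>c. \<forall>x\<in>X. (\<lambda>t. c * x t) \<in> X) \<and>
     (\<forall>x\<in>X. \<forall>y\<in>borel_measurable leb_I. (AE t in leb_I. \<bar>y t\<bar> \<le> \<bar>x t\<bar>) \<longrightarrow> y \<in> X) \<and>
     (\<forall>x\<in>X. \<forall>y\<in>L1. (AE t in leb_I. rearrangement y t \<le> rearrangement x t) \<longrightarrow> y \<in> X)"

section \<open>Sub-\<open>\<sigma>\<close>-algebras\<close>

definition sigma_subalgebra :: "real set set \<Rightarrow> bool" where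
  "sigma_subalgebra \<A> \<longleftrightarrow>
     sigma_algebra I \<A> \<and> \<A> \<subseteq> sets leb_I \<and> null_sets leb_I \<subseteq> \<A>"

text \<open>The null sets are added to the generators because a \<open>\<sigma>\<close>-subalgebra contains all of them.\<close>

definition finite_partition :: "real set set \<Rightarrow> bool" where
  "finite_partition \<A> \<longleftrightarrow>
     (\<exists>P. finite P \<and> P \<subseteq> sets leb_I \<and> disjoint P \<and>
        (\<forall>B\<in>P. measure leb_I B > 0) \<and> I - \<Union>P \<in> null_sets leb_I \<and>
        \<A> = sigma_sets I (P \<union> null_sets leb_I))"

definition independent_complement :: "real set set \<Rightarrow> real set set \<Rightarrow> bool" where
  "independent_complement \<A> \<B> \<longleftrightarrow>
     sigma_subalgebra \<A> \<and> sigma_subalgebra \<B> \<and>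
     sigma_sets I (\<A> \<union> \<B>) = sets leb_I \<and>
     (\<forall>D\<in>\<A>. \<forall>E\<in>\<B>. measure leb_I (D \<inter> E) = measure leb_I D * measure leb_I E)"

definition complemented :: "real set set \<Rightarrow> bool" where
  "complemented \<A> \<longleftrightarrow> (\<exists>\<B>. independent_complement \<A> \<B>)"

text \<open>\<^const>\<open>real_cond_exp\<close> depends only on the measurable sets of its second argument, so the
  zero measure carried by \<^term>\<open>sigma I \<A>\<close> plays no role.\<close>

definition averages :: "real set set \<Rightarrow> (real \<Rightarrow> real) set \<Rightarrow> bool" where
  "averages \<A> X \<longleftrightarrow> (\<forall>x\<in>X. real_cond_exp leb_I (sigma I \<A>) x \<in> X)"

definition universal :: "real set set \<Rightarrow> bool" where
  "universal \<A> \<longleftrightarrow> (\<forall>X. symmetric_ideal X \<longrightarrow> averages \<A> X)"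

end

theory Submission
  imports Defs
begin

text \<open>Membership of an integrable function \<open>y\<close> in a symmetric ideal
  depends only on its distribution function, and symmetric ideals are closed under dilation: it suffices that the
  distribution function of \<open>y\<close> is at most a constant multiple of that of a member
  (\<open>symmetric_ideal_dilation\<close>).

  Averaging over a finite partition gives bounded functions
  (\<open>universal_finite_partition\<close>). If \<open>\<A>\<close> is an independent complement of a finite partition, then
  on each block \<open>B\<close> every function agrees with an \<open>\<A>\<close>-measurable one, which is up to a factor the
  conditional expectation of the function cut off to \<open>B\<close>. By independence, extending
  from \<open>B\<close> to \<open>I\<close> multiplies distribution functions by a constant only, so that the conditional
  expectation is a finite sum of dilated pieces (\<open>universal_complement\<close>).

  Conversely, let \<open>\<B>\<close> be an independent complement of \<open>\<A>\<close>. A sub-\<open>\<sigma>\<close>-algebra that is not a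
  finite partition contains sets of arbitrarily small positive measure
  (\<open>finite_partition_if_no_small_sets\<close>). If this holds for both \<open>\<A>\<close> and \<open>\<B>\<close>, a function
  concentrated on small product sets \<open>A n \<inter> G n\<close> with \<open>A n \<in> \<A>\<close> and \<open>G n \<in> \<B>\<close> is spread by
  averaging over the much larger sets \<open>A n\<close>, which leads out of the symmetric ideal that the function
  generates (\<open>not_universal_small_sets\<close>). So a universal \<open>\<A>\<close> is a finite partition or \<open>\<B>\<close> is
  one, and \<open>\<A>\<close> is a complement of \<open>\<B>\<close>.\<close>

section \<open>Distribution functions\<close>

definition distr_fun :: "(real \<Rightarrow> real) \<Rightarrow> real \<Rightarrow> real" where
  "distr_fun f s = measure leb_I {t\<in>I. \<bar>f t\<bar> > s}"

lemma space_leb_I: "space leb_I = I"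
  by simp

lemma sets_superlevel [measurable]:
  fixes f :: "real \<Rightarrow> real"
  assumes [measurable]: "f \<in> borel_measurable leb_I"
  shows "{t\<in>I. \<bar>f t\<bar> > s} \<in> sets leb_I"
proof -
  have "{t\<in>space leb_I. \<bar>f t\<bar> > s} \<in> sets leb_I" by measurable
  then show ?thesis by simp
qed

lemma distr_fun_nonneg: "0 \<le> distr_fun f s"
  by (simp add: distr_fun_def)

lemma distr_fun_negative:
  assumes "s < 0"
  shows "distr_fun f s = 1"
proof -
  have "{t\<in>I. \<bar>f t\<bar> > s} = space leb_I" using assms by force
  then show ?thesis unfolding distr_fun_def using leb_I.prob_space by simp
qed

lemma distr_fun_mono_AE:
  assumes [measurable]: "x \<in> borel_measurable leb_I"
    and le: "AE t in leb_I. \<bar>y t\<bar> \<le> \<bar>x t\<bar>"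
  shows "distr_fun y s \<le> distr_fun x s"
  unfolding distr_fun_def
proof (rule leb_I.finite_measure_mono_AE)
  show "AE t in leb_I. t \<in> {t\<in>I. \<bar>y t\<bar> > s} \<longrightarrow> t \<in> {t\<in>I. \<bar>x t\<bar> > s}"
    using le by eventually_elim auto
qed measurable

lemma distr_fun_antimono:
  assumes [measurable]: "x \<in> borel_measurable leb_I" and "s \<le> s'"
  shows "distr_fun x s' \<le> distr_fun x s"
  unfolding distr_fun_def using assms(2) by (intro leb_I.finite_measure_mono sets_superlevel) auto

lemma distr_fun_eq_rearrangement:
  assumes "f \<in> borel_measurable leb_I"
  shows "distr_fun f s = measure leb_I {t\<in>I. rearrangement f t > s}"
  using is_rearrangement_rearrangement[OF assms] by (simp add: is_rearrangement_def distr_fun_def)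

lemma distr_fun_mono_rearrangement:
  assumes x: "x \<in> borel_measurable leb_I" and y: "y \<in> borel_measurable leb_I"
    and le: "AE t in leb_I. rearrangement y t \<le> rearrangement x t"
  shows "distr_fun y s \<le> distr_fun x s"
  unfolding distr_fun_eq_rearrangement[OF x] distr_fun_eq_rearrangement[OF y]
proof (rule leb_I.finite_measure_mono_AE)
  show "{t\<in>I. rearrangement x t > s} \<in> sets leb_I"
    using is_rearrangement_rearrangement[OF x]
    by (intro sets_antimono_superlevel) (simp add: is_rearrangement_def)
  show "AE t in leb_I. t \<in> {t\<in>I. rearrangement y t > s} \<longrightarrow> t \<in> {t\<in>I. rearrangement x t > s}"
    using le by eventually_elim auto
qed

text \<open>If the inequality failed at \<open>t\<close>, right continuity would give a level \<open>s\<close> which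
  the rearrangement of \<open>y\<close> exceeds on an interval strictly longer than \<open>(0,t]\<close>, while that
  of \<open>x\<close> exceeds it at most on \<open>(0,t)\<close>. The end point \<open>t = 1\<close> is excluded because right
  continuity says nothing there.\<close>

lemma rearrangement_mono_distr_fun:
  assumes mx: "x \<in> borel_measurable leb_I" and my: "y \<in> borel_measurable leb_I"
    and le: "\<And>s. distr_fun y s \<le> distr_fun x s" and t: "t \<in> {0<..<1}"
  shows "rearrangement y t \<le> rearrangement x t"
proof (rule ccontr)
  define g where "g = rearrangement y"
  define h where "h = rearrangement x"
  have g: "is_rearrangement y g" and h: "is_rearrangement x h"
    unfolding g_def h_def by (simp_all add: is_rearrangement_rearrangement mx my)
  assume "\<not> rearrangement y t \<le> rearrangement x t"
  then obtain s where s: "h t < s" "s < g t"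
    unfolding g_def h_def using dense by (metis not_le)
  have "(g \<longlongrightarrow> g t) (at t within {t..1})"
    using g t by (auto simp: is_rearrangement_def continuous_within)
  then have "\<forall>\<^sub>F r in at t within {t..1}. s < g r" by (rule order_tendstoD) (rule s)
  then obtain e where e: "e > 0" "\<And>r. r \<in> {t..1} \<Longrightarrow> r \<noteq> t \<Longrightarrow> dist r t < e \<Longrightarrow> s < g r"
    unfolding eventually_at by auto
  define u where "u = min 1 (t + e / 2)"
  have u: "t < u" "u \<le> 1" "s < g u"
    using e(1) t e(2)[of u] by (auto simp: u_def dist_real_def)
  have ag: "antimono_on I g" and ah: "antimono_on I h"
    using g h by (auto simp: is_rearrangement_def)
  have "{0<..u} \<subseteq> {r\<in>I. g r > s}"
  proof
    fix r assume r: "r \<in> {0<..u}"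
    have "g u \<le> g r" using ag r u t by (auto simp: monotone_on_def)
    then show "r \<in> {r\<in>I. g r > s}" using r u by auto
  qed
  then have "measure leb_I {0<..u} \<le> measure leb_I {r\<in>I. g r > s}"
    by (intro leb_I.finite_measure_mono sets_antimono_superlevel ag)
  also have "\<dots> = distr_fun y s" unfolding g_def by (simp add: distr_fun_eq_rearrangement my)
  also have "\<dots> \<le> distr_fun x s" by (rule le)
  also have "\<dots> = measure leb_I {r\<in>I. h r > s}"
    unfolding h_def by (simp add: distr_fun_eq_rearrangement mx)
  also have "\<dots> \<le> measure leb_I {0<..t}"
  proof (intro leb_I.finite_measure_mono subsetI)
    fix r assume r: "r \<in> {r\<in>I. h r > s}"
    show "r \<in> {0<..t}"
    proof (rule ccontr)
      assume "r \<notin> {0<..t}"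
      then have "h r \<le> h t" using ah r t by (auto simp: monotone_on_def)
      then show False using s r by auto
    qed
  qed (use t in \<open>auto simp: sets_restrict_space_iff\<close>)
  finally show False
    using u t by (simp add: measure_leb_I_interval)
qed

section \<open>Symmetric ideals are closed under dilation\<close>

lemma L1_measurable: "f \<in> L1 \<Longrightarrow> f \<in> borel_measurable leb_I"
  by (simp add: L1_def borel_measurable_integrable)

lemma symmetric_ideal_add:
  "symmetric_ideal X \<Longrightarrow> x \<in> X \<Longrightarrow> y \<in> X \<Longrightarrow> (\<lambda>t. x t + y t) \<in> X"
  unfolding symmetric_ideal_def by blast

lemma symmetric_ideal_solid:
  "symmetric_ideal X \<Longrightarrow> x \<in> X \<Longrightarrow> y \<in> borel_measurable leb_I \<Longrightarrow>
    AE t in leb_I. \<bar>y t\<bar> \<le> \<bar>x t\<bar> \<Longrightarrow> y \<in> X"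
  unfolding symmetric_ideal_def by blast

lemma symmetric_ideal_L1: "symmetric_ideal X \<Longrightarrow> x \<in> X \<Longrightarrow> x \<in> L1"
  unfolding symmetric_ideal_def by blast

lemma symmetric_ideal_bounded:
  "symmetric_ideal X \<Longrightarrow> x \<in> borel_measurable leb_I \<Longrightarrow> AE t in leb_I. \<bar>x t\<bar> \<le> C \<Longrightarrow> x \<in> X"
  unfolding symmetric_ideal_def Linf_def by blast

lemma symmetric_ideal_sum:
  assumes "symmetric_ideal X" "finite P" "\<And>B. B \<in> P \<Longrightarrow> y B \<in> X"
  shows "(\<lambda>t. \<Sum>B\<in>P. y B t) \<in> X"
  using assms(2,3)
proof (induction P rule: finite_induct)
  case empty
  show ?case using symmetric_ideal_bounded[OF assms(1), of "\<lambda>_. 0" 0] by simp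
next
  case (insert B P)
  then show ?case using symmetric_ideal_add[OF assms(1), of "y B" "\<lambda>t. \<Sum>B\<in>P. y B t"] by simp
qed

text \<open>The defining property of a symmetric ideal in terms of distribution functions, which,
  unlike rearrangements, are easy to estimate.\<close>

lemma symmetric_ideal_distr_fun_mono:
  assumes X: "symmetric_ideal X" and x: "x \<in> X" and y: "y \<in> L1"
    and le: "\<And>s. s \<ge> 0 \<Longrightarrow> distr_fun y s \<le> distr_fun x s"
  shows "y \<in> X"
proof -
  have "distr_fun y s \<le> distr_fun x s" for s
    using le[of s] by (cases "s \<ge> 0") (auto simp: distr_fun_negative)
  then have *: "rearrangement y t \<le> rearrangement x t" if "t \<in> {0<..<1}" for t
    by (intro rearrangement_mono_distr_fun L1_measurable y symmetric_ideal_L1[OF X x] that)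
  have "AE t in leb_I. t \<in> {0<..<1}"
  proof (rule AE_I'[of "{1}"])
    show "{1} \<in> null_sets leb_I" by (simp add: null_sets_restrict_space)
  qed auto
  then have "AE t in leb_I. rearrangement y t \<le> rearrangement x t"
    by eventually_elim (rule *)
  then show ?thesis using X x y unfolding symmetric_ideal_def by blast
qed

text \<open>By the intermediate value theorem, since the measure of \<open>S \<inter> (0,t]\<close> is 1-Lipschitz in \<open>t\<close>.\<close>

lemma halve_set:
  assumes S [measurable]: "S \<in> sets leb_I"
  shows "\<exists>C\<in>sets leb_I. C \<subseteq> S \<and> measure leb_I C = measure leb_I S / 2"
proof -
  define \<phi> where "\<phi> t = measure leb_I (S \<inter> {0<..t})" for t
  have M [measurable]: "{s<..t} \<inter> I \<in> sets leb_I" for s t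
    by (auto simp: sets_restrict_space_iff)
  have SM [measurable]: "S \<inter> {s<..t} \<in> sets leb_I" for s t
  proof -
    have "S \<inter> {s<..t} = S \<inter> ({s<..t} \<inter> I)" using sets.sets_into_space[OF S] by auto
    then show ?thesis using sets.Int[OF S M[of s t]] by simp
  qed
  have lip: "\<phi> s \<le> \<phi> t \<and> \<phi> t \<le> \<phi> s + (t - s)" if "0 \<le> s" "s \<le> t" "t \<le> 1" for s t
  proof
    show "\<phi> s \<le> \<phi> t" unfolding \<phi>_def
      by (rule leb_I.finite_measure_mono) (use that in auto)
    have "\<phi> t \<le> measure leb_I ((S \<inter> {0<..s}) \<union> {s<..t})" unfolding \<phi>_def
      by (rule leb_I.finite_measure_mono[OF _ sets.Un[OF SM]])
        (use that in \<open>auto simp: sets_restrict_space_iff\<close>)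
    also have "\<dots> \<le> \<phi> s + measure leb_I {s<..t}" unfolding \<phi>_def
      by (rule measure_Un_le[OF SM])
        (use that in \<open>auto simp: sets_restrict_space_iff\<close>)
    also have "measure leb_I {s<..t} = t - s"
      using that by (subst measure_restrict_space) auto
    finally show "\<phi> t \<le> \<phi> s + (t - s)" .
  qed
  have "dist (\<phi> s) (\<phi> t) \<le> dist s t" if "s \<in> {0..1}" "t \<in> {0..1}" for s t
    using lip[of s t] lip[of t s] that by (auto simp: dist_real_def abs_real_def split: if_splits)
  then have "continuous_on {0..1} \<phi>"
    unfolding continuous_on_iff by (meson le_less_trans)
  moreover have "\<phi> 0 = 0" by (simp add: \<phi>_def)
  moreover have "\<phi> 1 = measure leb_I S"
    using sets.sets_into_space[OF S] by (simp add: \<phi>_def Int_absorb2)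
  ultimately have "\<exists>t\<ge>0. t \<le> 1 \<and> \<phi> t = measure leb_I S / 2"
    by (intro IVT') (auto)
  then obtain t where "\<phi> t = measure leb_I S / 2" by blast
  then show ?thesis unfolding \<phi>_def
    by (intro bexI[of _ "S \<inter> {0<..t}"]) auto
qed

text \<open>Halving every level set of a function with countably many values gives one set that is
  independent of the function, which splits it into two pieces with equal distributions.\<close>

lemma halve_levels:
  fixes m :: "real \<Rightarrow> nat"
  assumes [measurable]: "m \<in> measurable leb_I (count_space UNIV)"
  shows "\<exists>C\<in>sets leb_I. \<forall>K. measure leb_I (C \<inter> {t\<in>I. m t \<in> K}) = measure leb_I {t\<in>I. m t \<in> K} / 2"
proof -
  define S where "S k = {t\<in>I. m t = k}" for k
  have L [measurable]: "{t\<in>I. m t \<in> K} \<in> sets leb_I" for K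
  proof -
    have "{t\<in>space leb_I. m t \<in> K} \<in> sets leb_I" by measurable
    then show ?thesis by simp
  qed
  have S [measurable]: "S k \<in> sets leb_I" for k using L[of "{k}"] by (simp add: S_def)
  have "\<forall>k. \<exists>C. C \<in> sets leb_I \<and> C \<subseteq> S k \<and> measure leb_I C = measure leb_I (S k) / 2"
    using halve_set[OF S] by blast
  then obtain C where C: "\<And>k. C k \<in> sets leb_I" "\<And>k. C k \<subseteq> S k"
    "\<And>k. measure leb_I (C k) = measure leb_I (S k) / 2" by metis
  note C(1)[measurable]
  have "measure leb_I ((\<Union>k. C k) \<inter> {t\<in>I. m t \<in> K}) = measure leb_I {t\<in>I. m t \<in> K} / 2" for K
  proof -
    define C' where "C' k = (if k \<in> K then C k else {})" for k
    define S' where "S' k = (if k \<in> K then S k else {})" for k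
    have "(\<Union>k. C k) \<inter> {t\<in>I. m t \<in> K} = (\<Union>k. C' k)"
      using C(2) by (fastforce simp: C'_def S_def split: if_splits)
    moreover have "{t\<in>I. m t \<in> K} = (\<Union>k. S' k)"
      by (auto simp: S'_def S_def split: if_splits)
    moreover have "(\<lambda>k. measure leb_I (C' k)) sums measure leb_I (\<Union>k. C' k)"
    proof (intro leb_I.finite_measure_UNION)
      show "range C' \<subseteq> sets leb_I" using C(1) by (auto simp: C'_def)
      have "C i \<inter> C j = {}" if "i \<noteq> j" for i j
        using C(2)[of i] C(2)[of j] that by (auto simp: S_def)
      then show "disjoint_family C'" by (auto simp: C'_def disjoint_family_on_def)
    qed
    moreover have "(\<lambda>k. measure leb_I (S' k)) sums measure leb_I (\<Union>k. S' k)"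
    proof (intro leb_I.finite_measure_UNION)
      show "range S' \<subseteq> sets leb_I" using S by (auto simp: S'_def)
      show "disjoint_family S'" by (auto simp: S'_def S_def disjoint_family_on_def)
    qed
    then have "(\<lambda>k. measure leb_I (S' k) / 2) sums (measure leb_I (\<Union>k. S' k) / 2)"
      by (rule sums_divide)
    moreover have "measure leb_I (C' k) = measure leb_I (S' k) / 2" for k
      by (simp add: C'_def S'_def C(3))
    ultimately show ?thesis by (simp only:) (rule sums_unique2)
  qed
  then show ?thesis by (intro bexI[of _ "\<Union>k. C k"]) auto
qed

text \<open>Up to a bounded function, \<open>|y|\<close> equals its integer part \<open>m\<close>. A set that halves all
  level sets of \<open>m\<close> splits it into two functions, each with half the distribution function of
  \<open>m\<close>, so that induction applies to both.\<close>

lemma symmetric_ideal_dilation: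
  assumes X: "symmetric_ideal X" and x: "x \<in> X" and y: "y \<in> L1"
    and le: "\<And>s. s \<ge> 0 \<Longrightarrow> distr_fun y s \<le> 2 ^ n * distr_fun x s"
  shows "y \<in> X"
  using y le
proof (induction n arbitrary: y)
  case 0
  then show ?case using symmetric_ideal_distr_fun_mono[OF X x] by simp
next
  case (Suc n)
  note [measurable] = L1_measurable[OF Suc.prems(1)]
  define m where "m t = nat \<lfloor>\<bar>y t\<bar>\<rfloor>" for t
  have m [measurable]: "m \<in> measurable leb_I (count_space UNIV)" unfolding m_def by measurable
  have m_le: "real (m t) \<le> \<bar>y t\<bar>" and le_m: "\<bar>y t\<bar> \<le> real (m t) + 1" for t
    unfolding m_def by linarith+
  obtain C where C [measurable]: "C \<in> sets leb_I"
    and half: "\<And>K. measure leb_I (C \<inter> {t\<in>I. m t \<in> K}) = measure leb_I {t\<in>I. m t \<in> K} / 2"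
    using halve_levels[OF m] by blast
  have L [measurable]: "{t\<in>I. m t \<in> K} \<in> sets leb_I" for K
  proof -
    have "{t\<in>space leb_I. m t \<in> K} \<in> sets leb_I" by measurable
    then show ?thesis by simp
  qed
  have half': "measure leb_I ({t\<in>I. m t \<in> K} - C) = measure leb_I {t\<in>I. m t \<in> K} / 2" for K
  proof -
    have "{t\<in>I. m t \<in> K} - C = {t\<in>I. m t \<in> K} - C \<inter> {t\<in>I. m t \<in> K}" by blast
    moreover have "measure leb_I ({t\<in>I. m t \<in> K} - C \<inter> {t\<in>I. m t \<in> K}) =
        measure leb_I {t\<in>I. m t \<in> K} - measure leb_I (C \<inter> {t\<in>I. m t \<in> K})"
      by (rule leb_I.finite_measure_Diff[OF L sets.Int[OF C L]]) auto
    ultimately show ?thesis using half[of K] by simp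
  qed
  have halfX: "(\<lambda>t. real (m t) * indicator D t) \<in> X"
    if [measurable]: "D \<in> sets leb_I"
      and D: "\<And>K. measure leb_I (D \<inter> {t\<in>I. m t \<in> K}) = measure leb_I {t\<in>I. m t \<in> K} / 2" for D
  proof (rule Suc.IH)
    have "\<bar>real (m t) * indicator D t\<bar> \<le> \<bar>y t\<bar>" for t
      using m_le[of t] by (auto simp: indicator_def)
    then show "(\<lambda>t. real (m t) * indicator D t) \<in> L1"
      using Suc.prems(1) unfolding L1_def mem_Collect_eq
      by (elim Bochner_Integration.integrable_bound) auto
    fix s :: real assume s: "s \<ge> 0"
    have "{t\<in>I. \<bar>real (m t) * indicator D t\<bar> > s} = D \<inter> {t\<in>I. m t \<in> {k. real k > s}}"
      using s by (auto simp: indicator_def split: if_splits)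
    then have "distr_fun (\<lambda>t. real (m t) * indicator D t) s = measure leb_I {t\<in>I. m t \<in> {k. real k > s}} / 2"
      unfolding distr_fun_def using D[of "{k. real k > s}"] by simp
    also have "measure leb_I {t\<in>I. m t \<in> {k. real k > s}} \<le> distr_fun y s"
      unfolding distr_fun_def
    proof (intro leb_I.finite_measure_mono subsetI)
      fix t assume "t \<in> {t\<in>I. m t \<in> {k. real k > s}}"
      then show "t \<in> {t\<in>I. \<bar>y t\<bar> > s}" using m_le[of t] by auto
    qed measurable
    also have "\<dots> \<le> 2 ^ Suc n * distr_fun x s" by (rule Suc.prems(2)[OF s])
    finally show "distr_fun (\<lambda>t. real (m t) * indicator D t) s \<le> 2 ^ n * distr_fun x s" by simp
  qed
  have "(\<lambda>t. real (m t) * indicator C t) \<in> X" by (rule halfX[OF C half])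
  moreover have "(\<lambda>t. real (m t) * indicator (I - C) t) \<in> X"
  proof (rule halfX)
    show "I - C \<in> sets leb_I" using sets.compl_sets[OF C] by simp
    show "measure leb_I ((I - C) \<inter> {t\<in>I. m t \<in> K}) = measure leb_I {t\<in>I. m t \<in> K} / 2" for K
    proof -
      have "(I - C) \<inter> {t\<in>I. m t \<in> K} = {t\<in>I. m t \<in> K} - C" by blast
      then show ?thesis using half'[of K] by (simp only:)
    qed
  qed
  moreover have "(\<lambda>t. 1) \<in> X" by (rule symmetric_ideal_bounded[OF X, of _ 1]) auto
  ultimately have "(\<lambda>t. (real (m t) * indicator C t + real (m t) * indicator (I - C) t) + 1) \<in> X"
    by (intro symmetric_ideal_add[OF X])
  moreover have "AE t in leb_I.
      \<bar>y t\<bar> \<le> \<bar>(real (m t) * indicator C t + real (m t) * indicator (I - C) t) + 1\<bar>"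
    using AE_space[of leb_I]
  proof eventually_elim
    case (elim t)
    then show ?case using le_m[of t] by (auto simp: indicator_def)
  qed
  ultimately show ?case
    by (rule symmetric_ideal_solid[OF X _ L1_measurable[OF Suc.prems(1)]])
qed

section \<open>Conditional expectations\<close>

lemma integral_indicator_leb_I:
  assumes "D \<in> sets leb_I"
  shows "(LINT t|leb_I. indicator D t) = measure leb_I D"
proof -
  have "D \<inter> space leb_I = D" using sets.sets_into_space[OF assms] by blast
  then show ?thesis using Bochner_Integration.integral_indicator[of leb_I D] by (simp only:)
qed

lemma integrable_indicator_leb_I:
  assumes "D \<in> sets leb_I"
  shows "integrable leb_I (indicator D :: real \<Rightarrow> real)"
  using assms by (intro leb_I.integrable_const_bound[where B = 1]) auto

lemma sets_sigma_subalgebra: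
  assumes "sigma_subalgebra \<A>"
  shows "sets (sigma I \<A>) = \<A>"
proof -
  interpret sigma_algebra I \<A> using assms by (simp add: sigma_subalgebra_def)
  show ?thesis using space_closed by (simp add: sets_measure_of sigma_sets_eq)
qed

lemma sigma_subalgebra_events: "sigma_subalgebra \<A> \<Longrightarrow> D \<in> \<A> \<Longrightarrow> D \<in> sets leb_I"
  by (auto simp: sigma_subalgebra_def)

lemma finite_measure_subalgebra_sigma:
  assumes "sigma_subalgebra \<A>"
  shows "finite_measure_subalgebra leb_I (sigma I \<A>)"
proof -
  have "subalgebra leb_I (sigma I \<A>)"
    unfolding subalgebra_def sets_sigma_subalgebra[OF assms]
    using assms by (simp add: space_measure_of_conv sigma_subalgebra_def)
  then show ?thesis
    unfolding finite_measure_subalgebra_def finite_measure_subalgebra_axioms_def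
    using leb_I.finite_measure_axioms by blast
qed

text \<open>Under conditioning, a factor independent of the \<open>\<sigma>\<close>-algebra is replaced by its mean. The case \<open>A = I\<close> says that the conditional
  expectation of the indicator of \<open>G\<close> is constant.\<close>

lemma cond_exp_indicator_independent:
  assumes \<A>: "sigma_subalgebra \<A>" and G [measurable]: "G \<in> sets leb_I" and A: "A \<in> \<A>"
    and indep: "\<And>D. D \<in> \<A> \<Longrightarrow> measure leb_I (D \<inter> G) = measure leb_I D * measure leb_I G"
  shows "AE t in leb_I. real_cond_exp leb_I (sigma I \<A>) (indicator (A \<inter> G)) t = measure leb_I G * indicator A t"
proof -
  interpret finite_measure_subalgebra leb_I "sigma I \<A>"
    by (rule finite_measure_subalgebra_sigma[OF \<A>])
  interpret SA: sigma_algebra I \<A> using \<A> by (simp add: sigma_subalgebra_def)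
  have [measurable]: "A \<in> sets leb_I" by (rule sigma_subalgebra_events[OF \<A> A])
  have AF [measurable]: "A \<in> sets (sigma I \<A>)" by (simp add: sets_sigma_subalgebra[OF \<A>] A)
  show ?thesis
  proof (rule real_cond_exp_charact)
    fix D assume "D \<in> sets (sigma I \<A>)"
    then have D: "D \<in> \<A>" by (simp add: sets_sigma_subalgebra[OF \<A>])
    have [measurable]: "D \<in> sets leb_I" by (rule sigma_subalgebra_events[OF \<A> D])
    have "(LINT t:D|leb_I. indicator (A \<inter> G) t) = (LINT t|leb_I. indicator ((D \<inter> A) \<inter> G) t :: real)"
      unfolding set_lebesgue_integral_def
      by (intro Bochner_Integration.integral_cong) (auto simp: indicator_def)
    also have "\<dots> = measure leb_I ((D \<inter> A) \<inter> G)" by (rule integral_indicator_leb_I) measurable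
    also have "\<dots> = measure leb_I (D \<inter> A) * measure leb_I G"
      by (rule indep) (use D A in blast)
    also have "\<dots> = (LINT t|leb_I. measure leb_I G * indicator (D \<inter> A) t)"
      by (simp add: integral_indicator_leb_I del: Bochner_Integration.integral_indicator)
    also have "\<dots> = (LINT t:D|leb_I. measure leb_I G * indicator A t)"
      unfolding set_lebesgue_integral_def
      by (intro Bochner_Integration.integral_cong) (auto simp: indicator_def)
    finally show "(LINT t:D|leb_I. indicator (A \<inter> G) t) = (LINT t:D|leb_I. measure leb_I G * indicator A t)" .
  qed (use AF in \<open>auto intro!: integrable_mult_right integrable_indicator_leb_I\<close>)
qed

section \<open>Finite partitions\<close>

definition partition_mod_null :: "real set set \<Rightarrow> bool" where
  "partition_mod_null P \<longleftrightarrow> finite P \<and> P \<subseteq> sets leb_I \<and> disjoint P \<and>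
     (\<forall>B\<in>P. measure leb_I B > 0) \<and> I - \<Union>P \<in> null_sets leb_I"

lemma finite_partition_iff:
  "finite_partition \<A> \<longleftrightarrow>
    (\<exists>P. partition_mod_null P \<and> \<A> = sigma_sets I (P \<union> null_sets leb_I))"
  unfolding finite_partition_def partition_mod_null_def by blast

lemma partition_events: "partition_mod_null P \<Longrightarrow> B \<in> P \<Longrightarrow> B \<in> sets leb_I"
  unfolding partition_mod_null_def by blast

lemma partition_measure_pos: "partition_mod_null P \<Longrightarrow> B \<in> P \<Longrightarrow> measure leb_I B > 0"
  unfolding partition_mod_null_def by blast

lemma sigma_sets_partition_events:
  assumes "partition_mod_null P" "D \<in> sigma_sets I (P \<union> null_sets leb_I)"
  shows "D \<in> sets leb_I"
proof -
  have "P \<union> null_sets leb_I \<subseteq> sets leb_I" using assms(1) by (auto simp: partition_mod_null_def)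
  then have "sigma_sets (space leb_I) (P \<union> null_sets leb_I) \<subseteq> sets leb_I" by (rule sets.sigma_sets_subset)
  then show ?thesis using assms(2) by (auto simp only: space_leb_I)
qed

text \<open>The sets that miss \<open>B\<close> or cover it, up to a null set, form a \<open>\<sigma>\<close>-algebra, and the generators
  are among them because the members of \<open>P\<close> are disjoint.\<close>

lemma partition_atom:
  assumes P: "partition_mod_null P" and B: "B \<in> P"
    and D: "D \<in> sigma_sets I (P \<union> null_sets leb_I)"
  shows "D \<inter> B \<in> null_sets leb_I \<or> B - D \<in> null_sets leb_I"
  using D
proof (induction rule: sigma_sets.induct)
  case (Basic a)
  then consider "a = B" | "a \<inter> B = {}" | "a \<in> null_sets leb_I"
    using P B by (auto simp: partition_mod_null_def disjoint_def)
  then show ?case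
  proof cases
    case 3
    moreover have "B \<in> sets leb_I" by (rule partition_events[OF P B])
    ultimately show ?thesis by (intro disjI1 null_set_Int2)
  qed auto
next
  case Empty
  then show ?case by simp
next
  case (Compl a)
  have "B \<subseteq> I" using sets.sets_into_space[OF partition_events[OF P B]] by simp
  then have "(I - a) \<inter> B = B - a" "B - (I - a) = a \<inter> B" by auto
  then show ?case using Compl.IH by auto
next
  case (Union a)
  have [measurable]: "B \<in> sets leb_I" by (rule partition_events[OF P B])
  have [measurable]: "a i \<in> sets leb_I" for i by (rule sigma_sets_partition_events[OF P Union.hyps])
  show ?case
  proof (cases "\<exists>i. B - a i \<in> null_sets leb_I")
    case True
    then obtain i where "B - a i \<in> null_sets leb_I" by blast
    then have "B - \<Union>(range a) \<in> null_sets leb_I" by (rule null_sets_subset) auto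
    then show ?thesis ..
  next
    case False
    then have "a i \<inter> B \<in> null_sets leb_I" for i using Union.IH by blast
    then have "(\<Union>i. a i \<inter> B) \<in> null_sets leb_I" by (intro null_sets_UN) auto
    moreover have "(\<Union>i. a i \<inter> B) = \<Union>(range a) \<inter> B" by blast
    ultimately show ?thesis by simp
  qed
qed

lemma partition_atom_AE:
  assumes P: "partition_mod_null P" and B: "B \<in> P"
    and D: "D \<in> sigma_sets I (P \<union> null_sets leb_I)"
  shows "(AE t in leb_I. t \<in> B \<longrightarrow> t \<notin> D) \<or> (AE t in leb_I. t \<in> B \<longrightarrow> t \<in> D)"
  using partition_atom[OF assms]
proof
  assume "D \<inter> B \<in> null_sets leb_I"
  then have "AE t in leb_I. t \<notin> D \<inter> B" by (rule AE_not_in)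
  then have "AE t in leb_I. t \<in> B \<longrightarrow> t \<notin> D" by eventually_elim blast
  then show ?thesis ..
next
  assume "B - D \<in> null_sets leb_I"
  then have "AE t in leb_I. t \<notin> B - D" by (rule AE_not_in)
  then have "AE t in leb_I. t \<in> B \<longrightarrow> t \<in> D" by eventually_elim blast
  then show ?thesis ..
qed

lemma partition_sum_indicator:
  assumes P: "partition_mod_null P"
  shows "AE t in leb_I. (\<Sum>B\<in>P. indicator B t) = (1 :: real)"
proof -
  have "I - \<Union>P \<in> null_sets leb_I" using P by (simp add: partition_mod_null_def)
  from AE_not_in[OF this] AE_space[of leb_I] show ?thesis
  proof eventually_elim
    case (elim t)
    have "finite P" "disjoint_family_on (\<lambda>B. B) P"
      using P by (auto simp: partition_mod_null_def disjoint_family_on_def disjoint_def)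
    then have "indicator (\<Union>((\<lambda>B. B) ` P)) t = (\<Sum>B\<in>P. indicator B t :: real)"
      by (rule indicator_UN_disjoint)
    then show ?case using elim by (auto simp: indicator_def)
  qed
qed

lemma partition_decomposition:
  assumes "partition_mod_null P"
  shows "AE t in leb_I. x t = (\<Sum>B\<in>P. indicator B t * x t :: real)"
  using partition_sum_indicator[OF assms]
  by eventually_elim (simp add: sum_distrib_right[symmetric])

lemma cond_exp_finite_partition:
  assumes P: "partition_mod_null P" and \<A>: "sigma_subalgebra \<A>"
    and \<A>_eq: "\<A> = sigma_sets I (P \<union> null_sets leb_I)"
    and x: "integrable leb_I x"
  shows "AE t in leb_I. real_cond_exp leb_I (sigma I \<A>) x t =
      (\<Sum>B\<in>P. (LINT t|leb_I. indicator B t * x t) / measure leb_I B * indicator B t)"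
proof -
  interpret finite_measure_subalgebra leb_I "sigma I \<A>"
    by (rule finite_measure_subalgebra_sigma[OF \<A>])
  define c where "c B = (LINT t|leb_I. indicator B t * x t) / measure leb_I B" for B
  note PM = partition_events[OF P]
  have "B \<in> \<A>" if "B \<in> P" for B using that \<A>_eq by auto
  then have PF: "B \<in> sets (sigma I \<A>)" if "B \<in> P" for B
    using that by (simp add: sets_sigma_subalgebra[OF \<A>])
  have int: "integrable leb_I (\<lambda>t. indicator D t * (indicator B t * h t))"
    if "integrable leb_I h" "D \<in> sets leb_I" "B \<in> sets leb_I" for h :: "real \<Rightarrow> real" and B D
  proof -
    have "integrable leb_I (\<lambda>t. indicator (D \<inter> B) t * h t)"
      using integrable_mult_indicator[OF sets.Int[OF that(2,3)] that(1)] by simp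
    then show ?thesis by (simp add: indicator_inter_arith mult.assoc)
  qed
  have int1: "integrable leb_I (\<lambda>t. indicator B t * h t)"
    if "integrable leb_I h" "B \<in> sets leb_I" for h :: "real \<Rightarrow> real" and B
    using integrable_mult_indicator[OF that(2,1)] by simp
  have piece: "(LINT t|leb_I. indicator D t * (indicator B t * x t)) =
      (LINT t|leb_I. indicator D t * (indicator B t * c B))"
    if D: "D \<in> \<A>" and B: "B \<in> P" for D B
  proof -
    note [measurable] = PM[OF B] sigma_subalgebra_events[OF \<A> D] borel_measurable_integrable[OF x]
    from D have "D \<in> sigma_sets I (P \<union> null_sets leb_I)" by (simp add: \<A>_eq)
    from partition_atom_AE[OF P B this] show ?thesis
    proof
      assume AE: "AE t in leb_I. t \<in> B \<longrightarrow> t \<notin> D"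
      have z: "(LINT t|leb_I. indicator D t * (indicator B t * h t)) = (LINT t|leb_I. 0)"
        if [measurable]: "h \<in> borel_measurable leb_I" for h :: "real \<Rightarrow> real"
        by (rule integral_cong_AE) (use AE in \<open>auto simp: indicator_def elim!: eventually_mono\<close>)
      show ?thesis by (simp only: z borel_measurable_integrable[OF x] borel_measurable_const)
    next
      assume AE: "AE t in leb_I. t \<in> B \<longrightarrow> t \<in> D"
      have z: "(LINT t|leb_I. indicator D t * (indicator B t * h t)) = (LINT t|leb_I. indicator B t * h t)"
        if [measurable]: "h \<in> borel_measurable leb_I" for h :: "real \<Rightarrow> real"
        by (rule integral_cong_AE) (use AE in \<open>auto simp: indicator_def elim!: eventually_mono\<close>)
      have "measure leb_I B > 0" by (rule partition_measure_pos[OF P B])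
      then have "(LINT t|leb_I. indicator B t * x t) = (LINT t|leb_I. indicator B t * c B)"
        by (simp add: c_def integral_indicator_leb_I PM[OF B] del: Bochner_Integration.integral_indicator)
      then show ?thesis by (simp only: z borel_measurable_integrable[OF x] borel_measurable_const)
    qed
  qed
  have "AE t in leb_I. real_cond_exp leb_I (sigma I \<A>) x t = (\<Sum>B\<in>P. c B * indicator B t)"
  proof (rule real_cond_exp_charact)
    fix D assume "D \<in> sets (sigma I \<A>)"
    then have D: "D \<in> \<A>" by (simp add: sets_sigma_subalgebra[OF \<A>])
    note [measurable] = sigma_subalgebra_events[OF \<A> D] borel_measurable_integrable[OF x] PM
    have "(LINT t:D|leb_I. x t) = (LINT t|leb_I. (\<Sum>B\<in>P. indicator D t * (indicator B t * x t)))"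
      unfolding set_lebesgue_integral_def
    proof (rule integral_cong_AE)
      show "AE t in leb_I. indicator D t *\<^sub>R x t = (\<Sum>B\<in>P. indicator D t * (indicator B t * x t))"
        using partition_decomposition[OF P, of x]
        by eventually_elim (simp add: sum_distrib_left[symmetric])
    qed measurable
    also have "\<dots> = (\<Sum>B\<in>P. LINT t|leb_I. indicator D t * (indicator B t * x t))"
      by (rule Bochner_Integration.integral_sum) (intro int x PM sigma_subalgebra_events[OF \<A> D])
    also have "\<dots> = (\<Sum>B\<in>P. LINT t|leb_I. indicator D t * (indicator B t * c B))"
      by (intro sum.cong refl piece D)
    also have "\<dots> = (LINT t|leb_I. (\<Sum>B\<in>P. indicator D t * (indicator B t * c B)))"
      by (rule Bochner_Integration.integral_sum[symmetric])
        (intro int PM sigma_subalgebra_events[OF \<A> D], auto)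
    also have "\<dots> = (LINT t:D|leb_I. (\<Sum>B\<in>P. c B * indicator B t))"
      unfolding set_lebesgue_integral_def by (simp add: sum_distrib_left mult_ac)
    finally show "(LINT t:D|leb_I. x t) = (LINT t:D|leb_I. (\<Sum>B\<in>P. c B * indicator B t))" .
  next
    show "integrable leb_I (\<lambda>t. \<Sum>B\<in>P. c B * indicator B t)"
      using int1[OF _ PM, of "\<lambda>_. c _"] by (intro Bochner_Integration.integrable_sum) (auto simp: mult.commute)
    show "(\<lambda>t. \<Sum>B\<in>P. c B * indicator B t) \<in> borel_measurable (sigma I \<A>)"
      using PF by measurable
  qed (rule x)
  then show ?thesis by (simp add: c_def)
qed

text \<open>The conditional expectation is a step function with finitely many values, hence bounded,
  and every symmetric ideal contains the bounded functions.\<close>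

lemma universal_finite_partition:
  assumes \<A>: "sigma_subalgebra \<A>" and "finite_partition \<A>"
  shows "universal \<A>"
  unfolding universal_def averages_def
proof (intro allI impI ballI)
  fix X x assume X: "symmetric_ideal X" and x: "x \<in> X"
  interpret finite_measure_subalgebra leb_I "sigma I \<A>"
    by (rule finite_measure_subalgebra_sigma[OF \<A>])
  obtain P where P: "partition_mod_null P" and \<A>_eq: "\<A> = sigma_sets I (P \<union> null_sets leb_I)"
    using assms(2) by (auto simp: finite_partition_iff)
  define c where "c B = (LINT t|leb_I. indicator B t * x t) / measure leb_I B" for B
  have "integrable leb_I x" using symmetric_ideal_L1[OF X x] by (simp add: L1_def)
  from cond_exp_finite_partition[OF P \<A> \<A>_eq this]
  have "AE t in leb_I. \<bar>real_cond_exp leb_I (sigma I \<A>) x t\<bar> \<le> (\<Sum>B\<in>P. \<bar>c B\<bar>)"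
  proof eventually_elim
    case (elim t)
    have "\<bar>\<Sum>B\<in>P. c B * indicator B t\<bar> \<le> (\<Sum>B\<in>P. \<bar>c B * indicator B t\<bar>)" by (rule sum_abs)
    also have "\<dots> \<le> (\<Sum>B\<in>P. \<bar>c B\<bar>)" by (intro sum_mono) (auto simp: indicator_def)
    finally show ?case by (simp add: elim c_def)
  qed
  then show "real_cond_exp leb_I (sigma I \<A>) x \<in> X"
    by (rule symmetric_ideal_bounded[OF X, rotated]) simp
qed

section \<open>Independent complements of finite partitions\<close>

text \<open>On a single block \<open>B\<close> of the partition the partition itself is trivial, so \<open>\<A>\<close> alone already
  traces out all measurable subsets of \<open>B\<close>.\<close>

lemma complement_trace:
  assumes P: "partition_mod_null P" and B: "B \<in> P"
    and ind: "independent_complement (sigma_sets I (P \<union> null_sets leb_I)) \<A>"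
    and T: "T \<in> sets leb_I"
  shows "\<exists>E\<in>\<A>. AE t in leb_I. t \<in> B \<longrightarrow> (t \<in> T \<longleftrightarrow> t \<in> E)"
proof -
  interpret SA: sigma_algebra I \<A>
    using ind by (simp add: independent_complement_def sigma_subalgebra_def)
  have "T \<in> sigma_sets I (sigma_sets I (P \<union> null_sets leb_I) \<union> \<A>)"
    using T ind by (simp add: independent_complement_def)
  then show ?thesis
  proof (induction rule: sigma_sets.induct)
    case (Basic D)
    then consider "D \<in> \<A>" | "AE t in leb_I. t \<in> B \<longrightarrow> t \<notin> D" | "AE t in leb_I. t \<in> B \<longrightarrow> t \<in> D"
      using partition_atom_AE[OF P B] by blast
    then show ?case
    proof cases
      case 1
      then show ?thesis by (intro bexI[of _ D]) auto
    next
      case 2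
      then show ?thesis by (intro bexI[of _ "{}"]) auto
    next
      case 3
      then have "AE t in leb_I. t \<in> B \<longrightarrow> (t \<in> D \<longleftrightarrow> t \<in> I)"
        using AE_space[of leb_I] by eventually_elim simp
      then show ?thesis by (intro bexI[of _ I]) auto
    qed
  next
    case Empty
    then show ?case by (intro bexI[of _ "{}"]) auto
  next
    case (Compl D)
    then obtain E where E: "E \<in> \<A>" and AE: "AE t in leb_I. t \<in> B \<longrightarrow> (t \<in> D \<longleftrightarrow> t \<in> E)" by blast
    have "AE t in leb_I. t \<in> B \<longrightarrow> (t \<in> I - D \<longleftrightarrow> t \<in> I - E)"
      using AE by eventually_elim blast
    then show ?case using E by (intro bexI[of _ "I - E"]) auto
  next
    case (Union D)
    then obtain E where E: "\<And>i. E i \<in> \<A>"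
      and AE: "\<And>i. AE t in leb_I. t \<in> B \<longrightarrow> (t \<in> D i \<longleftrightarrow> t \<in> E i)" by metis
    have "AE t in leb_I. \<forall>i. t \<in> B \<longrightarrow> (t \<in> D i \<longleftrightarrow> t \<in> E i)"
      unfolding AE_all_countable using AE by blast
    then have "AE t in leb_I. t \<in> B \<longrightarrow> (t \<in> \<Union>(range D) \<longleftrightarrow> t \<in> \<Union>(range E))"
      by eventually_elim blast
    then show ?case using E by (intro bexI[of _ "\<Union>(range E)"]) auto
  qed
qed

text \<open>Conditioning \<open>x\<close>, cut off to a block \<open>B\<close>, on the complement gives back a multiple of \<open>x\<close> on \<open>B\<close>
  and extends it to an \<open>\<A>\<close>-measurable function on \<open>I\<close>. Indeed the two sides have the same
  integral over each subset of \<open>B\<close>, since such a subset is the trace of some \<open>E \<in> \<A>\<close>, and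
  \<open>B\<close> is independent of \<open>E\<close>.\<close>

lemma cond_exp_complement:
  assumes P: "partition_mod_null P" and B: "B \<in> P"
    and ind: "independent_complement (sigma_sets I (P \<union> null_sets leb_I)) \<A>"
    and x: "integrable leb_I x"
  shows "AE t in leb_I. t \<in> B \<longrightarrow>
    real_cond_exp leb_I (sigma I \<A>) (\<lambda>t. indicator B t * x t) t = measure leb_I B * x t"
proof -
  have \<A>: "sigma_subalgebra \<A>" using ind by (simp add: independent_complement_def)
  interpret finite_measure_subalgebra leb_I "sigma I \<A>"
    by (rule finite_measure_subalgebra_sigma[OF \<A>])
  interpret SA: sigma_algebra I \<A> using \<A> by (simp add: sigma_subalgebra_def)
  define \<beta> where "\<beta> = measure leb_I B"
  define y where "y = real_cond_exp leb_I (sigma I \<A>) (\<lambda>t. indicator B t * x t)"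
  have B' [measurable]: "B \<in> sets leb_I" by (rule partition_events[OF P B])
  have xB [measurable]: "integrable leb_I (\<lambda>t. indicator B t * x t)"
    using integrable_mult_indicator[OF B' x] by simp
  have y [measurable]: "integrable leb_I y" unfolding y_def by (rule real_cond_exp_int(1)[OF xB])
  have yF [measurable]: "y \<in> borel_measurable (sigma I \<A>)" unfolding y_def by simp
  have yB: "integrable leb_I (\<lambda>t. indicator B t * y t)"
    using integrable_mult_indicator[OF B' y] by simp
  have "AE t in leb_I. real_cond_exp leb_I (sigma I \<A>) (indicator (I \<inter> B)) t = measure leb_I B * indicator I t"
  proof (rule cond_exp_indicator_independent[OF \<A> B' SA.top])
    fix D assume D: "D \<in> \<A>"
    have "B \<in> sigma_sets I (P \<union> null_sets leb_I)" using B by auto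
    then have "measure leb_I (B \<inter> D) = measure leb_I B * measure leb_I D"
      using ind D unfolding independent_complement_def by blast
    then show "measure leb_I (D \<inter> B) = measure leb_I D * measure leb_I B"
      by (simp add: Int_commute mult.commute)
  qed
  moreover have "I \<inter> B = B" using sets.sets_into_space[OF B'] by auto
  ultimately have "AE t in leb_I. real_cond_exp leb_I (sigma I \<A>) (indicator B) t = \<beta> * indicator I t"
    by (simp only: \<beta>_def)
  then have EB: "AE t in leb_I. real_cond_exp leb_I (sigma I \<A>) (indicator B) t = \<beta>"
    using AE_space[of leb_I] by eventually_elim simp
  have "AE t in leb_I. indicator B t * y t = \<beta> * (indicator B t * x t)"
  proof (rule density_unique_real[OF yB])
    show "integrable leb_I (\<lambda>t. \<beta> * (indicator B t * x t))" using xB by simp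
    fix T assume T [measurable]: "T \<in> sets leb_I"
    obtain E where E: "E \<in> \<A>" and AE: "AE t in leb_I. t \<in> B \<longrightarrow> (t \<in> T \<longleftrightarrow> t \<in> E)"
      using complement_trace[OF P B ind T] by blast
    have EF [measurable]: "E \<in> sets (sigma I \<A>)" by (simp add: sets_sigma_subalgebra[OF \<A>] E)
    have E' [measurable]: "E \<in> sets leb_I" by (rule sigma_subalgebra_events[OF \<A> E])
    have yE: "integrable leb_I (\<lambda>t. indicator E t * y t)"
      using integrable_mult_indicator[OF E' y] by simp
    have "(LINT t:T|leb_I. indicator B t * y t) = (LINT t|leb_I. (indicator E t * y t) * indicator B t)"
      unfolding set_lebesgue_integral_def
      by (rule integral_cong_AE) (use AE in \<open>auto simp: indicator_def elim!: eventually_mono\<close>)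
    \<comment> \<open>As \<open>indicator E * y\<close> is \<open>\<A>\<close>-measurable, \<open>indicator B\<close> may be conditioned, which makes it
      the constant \<open>\<beta>\<close>.\<close>
    also have "\<dots> = (LINT t|leb_I. (indicator E t * y t) * real_cond_exp leb_I (sigma I \<A>) (indicator B) t)"
    proof (rule real_cond_exp_intg(2)[symmetric])
      show "integrable leb_I (\<lambda>t. (indicator E t * y t) * indicator B t)"
        using integrable_mult_indicator[OF B' yE] by (simp add: mult.commute)
    qed measurable
    also have "\<dots> = (LINT t|leb_I. (indicator E t * y t) * \<beta>)"
      by (rule integral_cong_AE) (use EB in \<open>auto elim!: eventually_mono\<close>)
    also have "\<dots> = \<beta> * (LINT t:E|leb_I. y t)"
      unfolding set_lebesgue_integral_def by simp
    also have "(LINT t:E|leb_I. y t) = (LINT t:E|leb_I. indicator B t * x t)"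
      unfolding y_def by (rule real_cond_exp_intA[OF xB EF, symmetric])
    also have "\<dots> = (LINT t:T|leb_I. indicator B t * x t)"
      unfolding set_lebesgue_integral_def
    proof (rule integral_cong_AE)
      show "AE t in leb_I. indicator E t *\<^sub>R (indicator B t * x t) = indicator T t *\<^sub>R (indicator B t * x t)"
        using AE by eventually_elim (auto simp: indicator_def)
      show "(\<lambda>t. indicator E t *\<^sub>R (indicator B t * x t)) \<in> borel_measurable leb_I"
        "(\<lambda>t. indicator T t *\<^sub>R (indicator B t * x t)) \<in> borel_measurable leb_I"
        using borel_measurable_integrable[OF x] by measurable
    qed
    also have "\<beta> * \<dots> = (LINT t:T|leb_I. \<beta> * (indicator B t * x t))" by simp
    finally show "(LINT t:T|leb_I. indicator B t * y t) = (LINT t:T|leb_I. \<beta> * (indicator B t * x t))" .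
  qed
  then show ?thesis unfolding y_def \<beta>_def by eventually_elim (simp add: indicator_def split: if_splits)
qed

text \<open>For each block \<open>B\<close>, of measure \<open>\<beta>\<close>, let \<open>y B\<close> be the conditional expectation of \<open>x\<close> cut off
  to \<open>B\<close>. As \<open>y B\<close> is independent of \<open>B\<close> and equals \<open>\<beta> x\<close> there, its distribution
  function is at most \<open>1 / \<beta>\<close> times that of \<open>x\<close>. Hence \<open>y B\<close> lies in the ideal by the
  closure under dilation, and the conditional expectation of \<open>x\<close> is the finite sum of the \<open>y B\<close>.\<close>

lemma universal_complement:
  assumes fp: "finite_partition \<P>" and ind: "independent_complement \<P> \<A>"
  shows "universal \<A>"
  unfolding universal_def averages_def
proof (intro allI impI ballI)
  fix X x assume X: "symmetric_ideal X" and x: "x \<in> X"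
  have \<A>: "sigma_subalgebra \<A>" using ind by (simp add: independent_complement_def)
  interpret finite_measure_subalgebra leb_I "sigma I \<A>"
    by (rule finite_measure_subalgebra_sigma[OF \<A>])
  obtain P where P: "partition_mod_null P" and \<P>_eq: "\<P> = sigma_sets I (P \<union> null_sets leb_I)"
    using fp by (auto simp: finite_partition_iff)
  have ind': "independent_complement (sigma_sets I (P \<union> null_sets leb_I)) \<A>"
    using ind by (simp add: \<P>_eq)
  note PM = partition_events[OF P]
  have ix: "integrable leb_I x" using symmetric_ideal_L1[OF X x] by (simp add: L1_def)
  note mx [measurable] = borel_measurable_integrable[OF ix]
  have xB: "integrable leb_I (\<lambda>t. indicator B t * x t)" if "B \<in> P" for B
    using integrable_mult_indicator[OF PM[OF that] ix] by simp
  define y where "y B = real_cond_exp leb_I (sigma I \<A>) (\<lambda>t. indicator B t * x t)" for B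
  have yX: "y B \<in> X" if B: "B \<in> P" for B
  proof -
    define \<beta> where "\<beta> = measure leb_I B"
    note B' [measurable] = PM[OF B]
    have \<beta>: "\<beta> > 0" "\<beta> \<le> 1" using partition_measure_pos[OF P B] by (auto simp: \<beta>_def)
    obtain n where n: "1 / \<beta> < 2 ^ n" using real_arch_pow[of 2 "1 / \<beta>"] by auto
    have yF [measurable]: "y B \<in> borel_measurable (sigma I \<A>)" unfolding y_def by simp
    show ?thesis
    proof (rule symmetric_ideal_dilation[OF X x, where n = n])
      show "y B \<in> L1" unfolding L1_def y_def using real_cond_exp_int(1)[OF xB[OF B]] by simp
      fix s :: real assume s: "s \<ge> 0"
      define D where "D = {t\<in>I. \<bar>y B t\<bar> > s}"
      have "{t\<in>space (sigma I \<A>). \<bar>y B t\<bar> > s} \<in> sets (sigma I \<A>)" by measurable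
      then have D: "D \<in> \<A>" by (simp add: D_def space_measure_of_conv sets_sigma_subalgebra[OF \<A>])
      note [measurable] = sigma_subalgebra_events[OF \<A> D]
      have "B \<in> \<P>" using B by (auto simp: \<P>_eq)
      then have "measure leb_I (B \<inter> D) = \<beta> * measure leb_I D"
        using ind D by (simp add: independent_complement_def \<beta>_def)
      moreover have "measure leb_I (B \<inter> D) \<le> distr_fun x s"
        unfolding distr_fun_def
      proof (rule leb_I.finite_measure_mono_AE)
        show "AE t in leb_I. t \<in> B \<inter> D \<longrightarrow> t \<in> {t\<in>I. \<bar>x t\<bar> > s}"
          using cond_exp_complement[OF P B ind' ix]
        proof eventually_elim
          case (elim t)
          show ?case
          proof
            assume t: "t \<in> B \<inter> D"
            then have "\<bar>\<beta> * x t\<bar> > s" using elim by (auto simp: D_def y_def \<beta>_def)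
            moreover have "\<bar>\<beta> * x t\<bar> \<le> 1 * \<bar>x t\<bar>"
              unfolding abs_mult using \<beta> by (intro mult_right_mono) auto
            ultimately show "t \<in> {t\<in>I. \<bar>x t\<bar> > s}" using t by (auto simp: D_def)
          qed
        qed
      qed (rule sets_superlevel[OF mx])
      ultimately have "\<beta> * distr_fun (y B) s \<le> distr_fun x s"
        by (simp add: D_def distr_fun_def)
      then have "distr_fun (y B) s \<le> (1 / \<beta>) * distr_fun x s"
        using \<beta> by (simp add: field_simps)
      also have "\<dots> \<le> 2 ^ n * distr_fun x s"
        using n by (intro mult_right_mono distr_fun_nonneg) simp
      finally show "distr_fun (y B) s \<le> 2 ^ n * distr_fun x s" .
    qed
  qed
  \<comment> \<open>Additivity of conditional expectations is stated for families all of whose members are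
    integrable, so the family is \<open>0\<close> outside \<open>P\<close>.\<close>
  define f where "f B = (if B \<in> P then (\<lambda>t. indicator B t * x t) else (\<lambda>t. 0))" for B
  have f: "integrable leb_I (f B)" for B using xB by (auto simp: f_def)
  have "AE t in leb_I. x t = (\<Sum>B\<in>P. f B t)"
    using partition_decomposition[OF P, of x] by eventually_elim (simp add: f_def)
  then have "AE t in leb_I. real_cond_exp leb_I (sigma I \<A>) x t =
      real_cond_exp leb_I (sigma I \<A>) (\<lambda>t. \<Sum>B\<in>P. f B t) t"
    by (rule real_cond_exp_cong) (use f in \<open>auto intro!: borel_measurable_sum borel_measurable_integrable\<close>)
  moreover have "AE t in leb_I. real_cond_exp leb_I (sigma I \<A>) (\<lambda>t. \<Sum>B\<in>P. f B t) t =
      (\<Sum>B\<in>P. real_cond_exp leb_I (sigma I \<A>) (f B) t)"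
    by (rule real_cond_exp_sum[OF f])
  ultimately have "AE t in leb_I. \<bar>real_cond_exp leb_I (sigma I \<A>) x t\<bar> \<le> \<bar>(\<Sum>B\<in>P. y B t)\<bar>"
    by eventually_elim (simp add: y_def f_def)
  then show "real_cond_exp leb_I (sigma I \<A>) x \<in> X"
  proof (rule symmetric_ideal_solid[OF X, rotated 2])
    have "finite P" using P unfolding partition_mod_null_def by blast
    then show "(\<lambda>t. \<Sum>B\<in>P. y B t) \<in> X" using yX by (rule symmetric_ideal_sum[OF X])
  qed simp
qed

section \<open>Sub-\<open>\<sigma>\<close>-algebras without small sets\<close>

lemma card_disjoint_le:
  assumes "finite P" "P \<subseteq> sets leb_I" "disjoint P" "\<And>B. B \<in> P \<Longrightarrow> e \<le> measure leb_I B"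
  shows "real (card P) * e \<le> 1"
proof -
  have "real (card P) * e = (\<Sum>B\<in>P. e)" by simp
  also have "\<dots> \<le> (\<Sum>B\<in>P. measure leb_I B)" by (intro sum_mono assms(4))
  also have "\<dots> = measure leb_I (\<Union>B\<in>P. B)"
    by (rule leb_I.finite_measure_finite_Union[symmetric])
      (use assms(1-3) in \<open>auto simp: disjoint_family_on_def disjoint_def\<close>)
  also have "\<dots> \<le> 1" by simp
  finally show ?thesis .
qed

text \<open>A disjoint family of sets of measure at least \<open>e\<close> has at most \<open>1 / e\<close> members. One with
  the most members is a partition modulo null sets, and its members are atoms, since a set left
  over or a split atom would give a larger family.\<close>

lemma finite_partition_if_no_small_sets:
  assumes \<A>: "sigma_subalgebra \<A>" and e: "e > 0"
    and large: "\<And>D. D \<in> \<A> \<Longrightarrow> measure leb_I D > 0 \<Longrightarrow> e \<le> measure leb_I D"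
  shows "finite_partition \<A>"
proof -
  interpret SA: sigma_algebra I \<A> using \<A> by (simp add: sigma_subalgebra_def)
  note events = sigma_subalgebra_events[OF \<A>]
  define F where "F P \<longleftrightarrow> finite P \<and> P \<subseteq> \<A> \<and> disjoint P \<and> (\<forall>B\<in>P. measure leb_I B > 0)" for P
  have null: "D \<in> null_sets leb_I" if "D \<in> \<A>" "\<not> measure leb_I D > 0" for D
  proof -
    have "measure leb_I D = 0" using that(2) measure_nonneg[of leb_I D] by linarith
    then show ?thesis using events[OF that(1)] by (simp add: null_sets_def leb_I.emeasure_eq_measure)
  qed
  have bound: "card P < Suc (nat \<lceil>1 / e\<rceil>)" if "F P" for P
  proof -
    have "real (card P) * e \<le> 1"
      by (rule card_disjoint_le) (use that large events in \<open>auto simp: F_def\<close>)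
    then have "real (card P) \<le> 1 / e" using e by (simp add: field_simps)
    also have "\<dots> \<le> real (nat \<lceil>1 / e\<rceil>)" by linarith
    finally show ?thesis by simp
  qed
  have "F {}" by (simp add: F_def)
  then obtain P where P: "F P" and max: "\<And>Q. F Q \<Longrightarrow> card Q \<le> card P"
    using ex_has_greatest_nat[of F "{}" card "Suc (nat \<lceil>1 / e\<rceil>)"] bound less_imp_le by metis
  have P': "finite P" "P \<subseteq> \<A>" "disjoint P" "\<And>B. B \<in> P \<Longrightarrow> measure leb_I B > 0"
    using P by (auto simp: F_def)
  have R: "I - \<Union>P \<in> null_sets leb_I"
  proof (rule null)
    have "\<Union>P \<in> \<A>" using P' by auto
    then show RA: "I - \<Union>P \<in> \<A>" by auto
    show "\<not> measure leb_I (I - \<Union>P) > 0"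
    proof
      assume pos: "measure leb_I (I - \<Union>P) > 0"
      have nin: "I - \<Union>P \<notin> P"
      proof
        assume "I - \<Union>P \<in> P"
        then have "I - \<Union>P = {}" by blast
        then show False using pos by (metis less_irrefl measure_empty)
      qed
      have "disjoint (insert (I - \<Union>P) P)"
        using P'(3) unfolding disjoint_def by blast
      then have "F (insert (I - \<Union>P) P)" using P' RA pos unfolding F_def by blast
      then show False using max nin P'(1) by force
    qed
  qed
  have atom: "B \<inter> D \<in> null_sets leb_I \<or> B - D \<in> null_sets leb_I" if B: "B \<in> P" and D: "D \<in> \<A>" for B D
  proof (rule ccontr)
    assume neg: "\<not> ?thesis"
    have BA: "B \<in> \<A>" using B P' by blast
    have in_A: "B \<inter> D \<in> \<A>" "B - D \<in> \<A>" using BA D by auto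
    have pos: "measure leb_I (B \<inter> D) > 0" "measure leb_I (B - D) > 0"
      using neg null in_A by blast+
    define Q where "Q = insert (B \<inter> D) (insert (B - D) (P - {B}))"
    have ne: "B \<inter> D \<noteq> {}" "B - D \<noteq> {}" using pos by (metis less_irrefl measure_empty)+
    have dis: "C \<inter> B = {}" if "C \<in> P - {B}" for C using that B P'(3) by (auto simp: disjoint_def)
    have "disjoint Q" using P'(3) dis unfolding Q_def disjoint_def by blast
    then have "F Q" using P' in_A pos unfolding F_def Q_def by blast
    moreover have "C \<notin> P - {B}" if "C \<subseteq> B" "C \<noteq> {}" for C
      using dis[of C] that by (auto simp: Int_absorb2)
    from this[of "B \<inter> D"] this[of "B - D"] ne
    have "B \<inter> D \<notin> P - {B}" "B - D \<notin> P - {B}" by auto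
    moreover have "B \<inter> D \<noteq> B - D" using ne(1) by blast
    ultimately have "card Q = Suc (Suc (card (P - {B})))" using P'(1) by (simp add: Q_def)
    also have "\<dots> = Suc (card P)" by (simp only: card_Suc_Diff1[OF P'(1) B])
    finally show False using max[OF \<open>F Q\<close>] by simp
  qed
  have gen: "P \<union> null_sets leb_I \<subseteq> \<A>" using P'(2) \<A> by (auto simp: sigma_subalgebra_def)
  have part: "partition_mod_null P"
    unfolding partition_mod_null_def using P' R events by blast
  have "\<A> = sigma_sets I (P \<union> null_sets leb_I)"
  proof
    show "sigma_sets I (P \<union> null_sets leb_I) \<subseteq> \<A>" by (rule SA.sigma_sets_subset[OF gen])
    interpret SS: sigma_algebra I "sigma_sets I (P \<union> null_sets leb_I)"
      by (rule sigma_algebra_sigma_sets) (use gen SA.space_closed in blast)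
    show "\<A> \<subseteq> sigma_sets I (P \<union> null_sets leb_I)"
    proof
      fix D assume D: "D \<in> \<A>"
      \<comment> \<open>\<open>D\<close> agrees up to null sets with the union of the atoms it contains.\<close>
      define U where "U = \<Union>{B\<in>P. B - D \<in> null_sets leb_I}"
      have UA: "U \<in> \<A>" using P' by (auto simp: U_def)
      have US: "U \<in> sigma_sets I (P \<union> null_sets leb_I)"
        unfolding U_def using P'(1) by (intro SS.finite_Union) auto
      have "(\<Union>B\<in>{B\<in>P. B - D \<in> null_sets leb_I}. B - D) \<in> null_sets leb_I"
        using P'(1) by (intro null_sets.finite_UN) auto
      moreover have "(\<Union>B\<in>{B\<in>P. B - D \<in> null_sets leb_I}. B - D) = U - D"
        unfolding U_def by blast
      ultimately have "U - D \<in> null_sets leb_I" by simp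
      moreover have "D - U \<in> null_sets leb_I"
      proof (rule null_sets_subset)
        have "(\<Union>B\<in>{B\<in>P. B \<inter> D \<in> null_sets leb_I}. B \<inter> D) \<in> null_sets leb_I"
          using P'(1) by (intro null_sets.finite_UN) auto
        then show "(I - \<Union>P) \<union> (\<Union>B\<in>{B\<in>P. B \<inter> D \<in> null_sets leb_I}. B \<inter> D) \<in> null_sets leb_I"
          using R by (rule null_sets.Un[rotated])
        show "D - U \<in> sets leb_I" using events D UA by blast
        show "D - U \<subseteq> (I - \<Union>P) \<union> (\<Union>B\<in>{B\<in>P. B \<inter> D \<in> null_sets leb_I}. B \<inter> D)"
          using atom[OF _ D] SA.sets_into_space[OF D] unfolding U_def by blast
      qed
      ultimately have parts: "U - D \<in> sigma_sets I (P \<union> null_sets leb_I)"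
        "D - U \<in> sigma_sets I (P \<union> null_sets leb_I)"
        by (blast intro: sigma_sets.Basic)+
      have "U - (U - D) \<union> (D - U) \<in> sigma_sets I (P \<union> null_sets leb_I)"
        by (rule SS.Un[OF SS.Diff[OF US parts(1)] parts(2)])
      moreover have "U - (U - D) \<union> (D - U) = D" by blast
      ultimately show "D \<in> sigma_sets I (P \<union> null_sets leb_I)" by simp
    qed
  qed
  then show ?thesis using part by (auto simp: finite_partition_iff)
qed

section \<open>The symmetric ideal generated by a function\<close>

text \<open>A concrete form of the symmetric ideal generated by \<open>x\<close>. A single constant \<open>N\<close> serves as scale
  and as dilation factor. Only levels \<open>u \<ge> 1\<close> are compared, so that bounded functions belong to
  it even when \<open>x\<close> is small.\<close>

definition dilation_ideal :: "(real \<Rightarrow> real) \<Rightarrow> (real \<Rightarrow> real) set" where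
  "dilation_ideal x = {y\<in>L1. \<exists>N::nat. \<forall>u\<ge>1. distr_fun y (real N * u) \<le> real N * distr_fun x u}"

lemma dilation_ideal_mono:
  assumes y: "y \<in> borel_measurable leb_I"
    and N: "\<And>u. u \<ge> 1 \<Longrightarrow> distr_fun y (real N * u) \<le> real N * distr_fun x u"
    and "N \<le> N'" "u \<ge> 1"
  shows "distr_fun y (real N' * u) \<le> real N' * distr_fun x u"
proof -
  have "distr_fun y (real N' * u) \<le> distr_fun y (real N * u)"
    using assms by (intro distr_fun_antimono y mult_right_mono) auto
  also have "\<dots> \<le> real N * distr_fun x u" by (rule N) fact
  also have "\<dots> \<le> real N' * distr_fun x u"
    using assms by (intro mult_right_mono distr_fun_nonneg) auto
  finally show ?thesis .
qed

lemma symmetric_ideal_dilation_ideal: "symmetric_ideal (dilation_ideal x)"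
  unfolding symmetric_ideal_def
proof (intro conjI ballI allI impI subsetI)
  fix y assume "y \<in> Linf"
  then obtain C where y [measurable]: "y \<in> borel_measurable leb_I" and C: "AE t in leb_I. \<bar>y t\<bar> \<le> C"
    by (auto simp: Linf_def)
  obtain N :: nat where N: "C \<le> real N" using real_arch_simple by blast
  have "y \<in> L1" unfolding L1_def using C by (auto intro: leb_I.integrable_const_bound[where B = C])
  moreover have "distr_fun y (real N * u) \<le> real N * distr_fun x u" if "u \<ge> 1" for u
  proof -
    have "real N * 1 \<le> real N * u" using that by (intro mult_left_mono) auto
    then have "AE t in leb_I. t \<in> {t\<in>I. \<bar>y t\<bar> > real N * u} \<longrightarrow> t \<in> {}"
      using C
    proof eventually_elim
      case (elim t)
      then have "\<not> real N * u < \<bar>y t\<bar>" using N \<open>real N * 1 \<le> real N * u\<close> by linarith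
      with elim show ?case by simp
    qed
    then have "distr_fun y (real N * u) \<le> measure leb_I {}"
      unfolding distr_fun_def by (intro leb_I.finite_measure_mono_AE) auto
    also have "\<dots> \<le> real N * distr_fun x u" by (simp add: distr_fun_nonneg)
    finally show ?thesis .
  qed
  ultimately show "y \<in> dilation_ideal x" unfolding dilation_ideal_def by blast
next
  fix y assume "y \<in> dilation_ideal x" then show "y \<in> L1" by (simp add: dilation_ideal_def)
next
  fix y z assume "y \<in> dilation_ideal x" "z \<in> dilation_ideal x"
  then obtain N1 N2 where y: "y \<in> L1" and z: "z \<in> L1"
    and N1: "\<And>u. u \<ge> 1 \<Longrightarrow> distr_fun y (real N1 * u) \<le> real N1 * distr_fun x u"
    and N2: "\<And>u. u \<ge> 1 \<Longrightarrow> distr_fun z (real N2 * u) \<le> real N2 * distr_fun x u"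
    by (auto simp: dilation_ideal_def)
  note my = L1_measurable[OF y] and mz = L1_measurable[OF z]
  define N where "N = max N1 N2"
  have "distr_fun (\<lambda>t. y t + z t) (real (2 * N) * u) \<le> real (2 * N) * distr_fun x u" if "u \<ge> 1" for u
  proof -
    have "distr_fun (\<lambda>t. y t + z t) (real (2 * N) * u) \<le>
        measure leb_I ({t\<in>I. \<bar>y t\<bar> > real N * u} \<union> {t\<in>I. \<bar>z t\<bar> > real N * u})"
      unfolding distr_fun_def
      by (intro leb_I.finite_measure_mono sets.Un sets_superlevel my mz) auto
    also have "\<dots> \<le> distr_fun y (real N * u) + distr_fun z (real N * u)"
      unfolding distr_fun_def by (rule measure_Un_le) (intro sets_superlevel my mz)+
    also have "\<dots> \<le> real N * distr_fun x u + real N * distr_fun x u"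
      by (intro add_mono dilation_ideal_mono[OF my N1] dilation_ideal_mono[OF mz N2] that)
        (auto simp: N_def)
    finally show ?thesis by simp
  qed
  moreover have "(\<lambda>t. y t + z t) \<in> L1" using y z by (simp add: L1_def)
  ultimately show "(\<lambda>t. y t + z t) \<in> dilation_ideal x" unfolding dilation_ideal_def by blast
next
  fix c y assume "y \<in> dilation_ideal x"
  then obtain N where y: "y \<in> L1"
    and N: "\<And>u. u \<ge> 1 \<Longrightarrow> distr_fun y (real N * u) \<le> real N * distr_fun x u"
    by (auto simp: dilation_ideal_def)
  note my = L1_measurable[OF y]
  obtain k0 :: nat where k0: "\<bar>c\<bar> \<le> real k0" using real_arch_simple by blast
  define k where "k = Suc k0"
  have k: "\<bar>c\<bar> \<le> real k" "real k \<ge> 1" using k0 by (auto simp: k_def)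
  have "distr_fun (\<lambda>t. c * y t) (real (N * k) * u) \<le> real (N * k) * distr_fun x u" if "u \<ge> 1" for u
  proof -
    have "\<bar>y t\<bar> > real N * u" if "\<bar>c * y t\<bar> > real (N * k) * u" for t
    proof (rule ccontr)
      assume "\<not> \<bar>y t\<bar> > real N * u"
      then have "\<bar>c\<bar> * \<bar>y t\<bar> \<le> real k * (real N * u)" using k by (intro mult_mono) auto
      then show False using that by (simp add: abs_mult mult_ac)
    qed
    then have "distr_fun (\<lambda>t. c * y t) (real (N * k) * u) \<le> distr_fun y (real N * u)"
      unfolding distr_fun_def by (intro leb_I.finite_measure_mono sets_superlevel my) auto
    also have "\<dots> \<le> real N * distr_fun x u" by (rule N[OF that])
    also have "\<dots> \<le> real (N * k) * distr_fun x u"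
      by (intro mult_right_mono distr_fun_nonneg) (simp add: k_def)
    finally show ?thesis .
  qed
  moreover have "(\<lambda>t. c * y t) \<in> L1" using y by (simp add: L1_def)
  ultimately show "(\<lambda>t. c * y t) \<in> dilation_ideal x" unfolding dilation_ideal_def by blast
next
  fix y z assume "y \<in> dilation_ideal x" and mz: "z \<in> borel_measurable leb_I"
    and le: "AE t in leb_I. \<bar>z t\<bar> \<le> \<bar>y t\<bar>"
  then obtain N where y: "y \<in> L1"
    and N: "\<And>u. u \<ge> 1 \<Longrightarrow> distr_fun y (real N * u) \<le> real N * distr_fun x u"
    unfolding dilation_ideal_def by blast
  have "z \<in> L1"
    unfolding L1_def mem_Collect_eq
    by (rule Bochner_Integration.integrable_bound[of _ y])
      (use y mz le in \<open>simp_all add: L1_def\<close>)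
  moreover have "distr_fun z (real N * u) \<le> real N * distr_fun x u" if "u \<ge> 1" for u
    using distr_fun_mono_AE[OF L1_measurable[OF y] le] N[OF that] by (rule order_trans)
  ultimately show "z \<in> dilation_ideal x" unfolding dilation_ideal_def by blast
next
  fix y z assume "y \<in> dilation_ideal x" and z: "z \<in> L1"
    and le: "AE t in leb_I. rearrangement z t \<le> rearrangement y t"
  then obtain N where y: "y \<in> L1"
    and N: "\<And>u. u \<ge> 1 \<Longrightarrow> distr_fun y (real N * u) \<le> real N * distr_fun x u"
    unfolding dilation_ideal_def by blast
  have "distr_fun z (real N * u) \<le> real N * distr_fun x u" if "u \<ge> 1" for u
    using distr_fun_mono_rearrangement[OF L1_measurable[OF y] L1_measurable[OF z] le] N[OF that]
    by (rule order_trans)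
  then show "z \<in> dilation_ideal x" using z unfolding dilation_ideal_def by blast
qed

lemma mem_dilation_ideal_self: "x \<in> L1 \<Longrightarrow> x \<in> dilation_ideal x"
  unfolding dilation_ideal_def by (intro CollectI conjI exI[of _ 1]) auto

section \<open>Averaging over independent small sets\<close>

text \<open>Choose \<open>G n \<in> \<B>\<close> of measure \<open>\<gamma> n \<rightarrow> 0\<close> and \<open>A n \<in> \<A>\<close> of measure \<open>\<alpha> n\<close> decreasing
  very fast, and let \<open>x\<close> be the sum of the heights \<open>c n = f n / \<gamma> n\<close> on the sets \<open>A n \<inter> G n\<close>,
  where \<open>f n = (1/2)^n / \<alpha> n\<close>. The integral of the \<open>n\<close>-th term is \<open>(1/2)^n\<close>, so \<open>x\<close> is integrable.
  Averaging spreads each term over all of \<open>A n\<close>: the conditional expectation of \<open>x\<close> is at least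
  \<open>f n\<close> on a set of measure \<open>\<alpha> n\<close>. In contrast, \<open>x\<close> exceeds \<open>T n = c 0 + \<dots> + c (n - 1)\<close> only on
  the union of the \<open>A m \<inter> G m\<close> with \<open>m \<ge> n\<close>, whose measure is at most \<open>\<alpha> n / (2 (n + 1))\<close>. As
  \<open>f n\<close> is chosen larger than \<open>n * max 1 (T n)\<close>, no dilation of \<open>x\<close> dominates the conditional
  expectation.\<close>

lemma not_universal_small_sets:
  assumes \<A>: "sigma_subalgebra \<A>" and \<B>: "sigma_subalgebra \<B>"
    and indep: "\<And>D G. D \<in> \<A> \<Longrightarrow> G \<in> \<B> \<Longrightarrow>
      measure leb_I (D \<inter> G) = measure leb_I D * measure leb_I G"
    and smallA: "\<And>e. e > 0 \<Longrightarrow> \<exists>D\<in>\<A>. 0 < measure leb_I D \<and> measure leb_I D < e"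
    and smallB: "\<And>e. e > 0 \<Longrightarrow> \<exists>G\<in>\<B>. 0 < measure leb_I G \<and> measure leb_I G < e"
  shows "\<not> universal \<A>"
proof
  assume univ: "universal \<A>"
  interpret finite_measure_subalgebra leb_I "sigma I \<A>"
    by (rule finite_measure_subalgebra_sigma[OF \<A>])
  have "\<forall>n. \<exists>G. G \<in> \<B> \<and> 0 < measure leb_I G \<and> measure leb_I G < 1 / (4 * (real n + 1))"
    using smallB[of "1 / (4 * (real _ + 1))"] by (auto simp: Bex_def)
  then obtain G where G: "\<And>n. G n \<in> \<B>" "\<And>n. 0 < measure leb_I (G n)"
    "\<And>n. measure leb_I (G n) < 1 / (4 * (real n + 1))" by metis
  define \<gamma> where "\<gamma> n = measure leb_I (G n)" for n
  have \<gamma>: "0 < \<gamma> n" "\<gamma> n < 1 / (4 * (real n + 1))" for n using G by (auto simp: \<gamma>_def)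
  have pick: "\<exists>D\<in>\<A>. 0 < measure leb_I D \<and> measure leb_I D < d \<and>
      real n * max 1 T < (1 / 2) ^ n / measure leb_I D" if "d > 0" for n T and d :: real
  proof -
    define K where "K = real n * max 1 T + 1"
    have K: "K > 0" unfolding K_def by (intro add_nonneg_pos mult_nonneg_nonneg) auto
    have "min d ((1 / 2) ^ n / K) > 0" using that K by simp
    from smallA[OF this] obtain D where D: "D \<in> \<A>" "0 < measure leb_I D" "measure leb_I D < d"
      "measure leb_I D < (1 / 2) ^ n / K" by auto
    then have "K < (1 / 2) ^ n / measure leb_I D" using K by (simp add: field_simps)
    then show ?thesis using D by (intro bexI[of _ D]) (auto simp: K_def)
  qed
  \<comment> \<open>The recursion carries the partial sum \<open>T\<close> of the heights along with the set \<open>D\<close>, because how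
    small the next set must be depends on \<open>T\<close>.\<close>
  define Pr where "Pr n s \<longleftrightarrow> (case s of (D, T) \<Rightarrow> D \<in> \<A> \<and> 0 < measure leb_I D \<and>
      real n * max 1 T < (1 / 2) ^ n / measure leb_I D \<and> (n = 0 \<longrightarrow> T = 0))"
    for n and s :: "real set \<times> real"
  define Qr where "Qr n s s' \<longleftrightarrow> (case s of (D, T) \<Rightarrow> case s' of (D', T') \<Rightarrow>
      measure leb_I D' \<le> measure leb_I D / 2 \<and> T' = T + (1 / 2) ^ n / measure leb_I D / \<gamma> n)"
    for n and s s' :: "real set \<times> real"
  have "\<exists>f. \<forall>n. Pr n (f n) \<and> Qr n (f n) (f (Suc n))"
  proof (rule dependent_nat_choice)
    obtain D where "D \<in> \<A>" "0 < measure leb_I D" using smallA[of 1] by auto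
    then show "\<exists>s. Pr 0 s" by (intro exI[of _ "(D, 0)"]) (simp add: Pr_def)
  next
    fix s n assume "Pr n s"
    then obtain D T where s: "s = (D, T)" and D: "0 < measure leb_I D" by (auto simp: Pr_def)
    define T' where "T' = T + (1 / 2) ^ n / measure leb_I D / \<gamma> n"
    obtain D' where "D' \<in> \<A>" "0 < measure leb_I D'" "measure leb_I D' < measure leb_I D / 2"
      "real (Suc n) * max 1 T' < (1 / 2) ^ Suc n / measure leb_I D'"
      using pick[of "measure leb_I D / 2" "Suc n" T'] D by auto
    then show "\<exists>s'. Pr (Suc n) s' \<and> Qr n s s'"
      by (intro exI[of _ "(D', T')"]) (simp add: Pr_def Qr_def s T'_def)
  qed
  then obtain st where st: "\<And>n. Pr n (st n)" "\<And>n. Qr n (st n) (st (Suc n))" by blast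
  define A where "A n = fst (st n)" for n
  define T where "T n = snd (st n)" for n
  define \<alpha> where "\<alpha> n = measure leb_I (A n)" for n
  define f where "f n = (1 / 2) ^ n / \<alpha> n" for n
  define c where "c n = f n / \<gamma> n" for n
  have A: "A n \<in> \<A>" and \<alpha>: "\<alpha> n > 0" and f_large: "real n * max 1 (T n) < f n" for n
    using st(1)[of n] by (auto simp: Pr_def A_def T_def \<alpha>_def f_def split: prod.splits)
  have T0: "T 0 = 0" using st(1)[of 0] by (auto simp: Pr_def T_def split: prod.splits)
  have \<alpha>_Suc: "\<alpha> (Suc n) \<le> \<alpha> n / 2" and T_Suc: "T (Suc n) = T n + c n" for n
    using st(2)[of n] by (auto simp: Qr_def A_def T_def \<alpha>_def f_def c_def split: prod.splits)
  have T_sum: "T n = (\<Sum>m<n. c m)" for n by (induction n) (simp_all add: T0 T_Suc)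
  have f: "f n > 0" and c: "c n > 0" for n using \<alpha> \<gamma> by (auto simp: f_def c_def)
  have \<alpha>_add: "\<alpha> (n + m) \<le> \<alpha> n * (1 / 2) ^ m" for n m
  proof (induction m)
    case (Suc m)
    then show ?case using \<alpha>_Suc[of "n + m"] by simp
  qed simp
  define F where "F n = A n \<inter> G n" for n
  have Am [measurable]: "A n \<in> sets leb_I" for n by (rule sigma_subalgebra_events[OF \<A> A])
  have Gm [measurable]: "G n \<in> sets leb_I" for n by (rule sigma_subalgebra_events[OF \<B> G(1)])
  have Fm [measurable]: "F n \<in> sets leb_I" for n unfolding F_def by measurable
  have F_measure: "measure leb_I (F n) = \<alpha> n * \<gamma> n" for n
    unfolding F_def \<alpha>_def \<gamma>_def by (rule indep[OF A G(1)])
  have F_tail: "measure leb_I (F (m + n)) \<le> \<alpha> n / (4 * (real n + 1)) * (1 / 2) ^ m" for n m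
  proof -
    have "\<gamma> (m + n) \<le> 1 / (4 * (real (m + n) + 1))" using \<gamma>(2)[of "m + n"] by simp
    also have "\<dots> \<le> 1 / (4 * (real n + 1))" by (intro divide_left_mono) auto
    finally have "\<alpha> (n + m) * \<gamma> (m + n) \<le> (\<alpha> n * (1 / 2) ^ m) * (1 / (4 * (real n + 1)))"
      using \<alpha> \<gamma> \<alpha>_add by (intro mult_mono) (auto intro: less_imp_le)
    then show ?thesis by (simp add: F_measure add.commute)
  qed
  have geom: "summable (\<lambda>m. C * (1 / 2) ^ m :: real)" for C by (intro summable_mult summable_geometric) auto
  have F_summable: "summable (\<lambda>m. measure leb_I (F (m + n)))" for n
    by (rule summable_comparison_test'[OF geom[of "\<alpha> n / (4 * (real n + 1))"], where N = 0])
      (use F_tail[of _ n] in simp)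
  define g where "g n t = c n * indicator (F n) t" for n t
  have g_nonneg: "g n t \<ge> 0" for n t using c[of n] by (simp add: g_def)
  have g_int: "integrable leb_I (g n)" for n
    unfolding g_def by (intro integrable_mult_right integrable_indicator_leb_I Fm)
  \<comment> \<open>By Borel--Cantelli the series defining \<open>x\<close> has only finitely many nonzero terms almost
    everywhere.\<close>
  have "AE t in leb_I. eventually (\<lambda>n. t \<in> space leb_I - F n) sequentially"
    by (rule borel_cantelli_AE1[OF Fm]) (use F_summable[of 0] in \<open>auto simp: less_top[symmetric]\<close>)
  then have g_summable: "AE t in leb_I. summable (\<lambda>n. g n t)"
  proof eventually_elim
    case (elim t)
    then obtain n0 where "\<And>n. n \<ge> n0 \<Longrightarrow> t \<notin> F n" by (auto simp: eventually_sequentially)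
    then have "g n t = 0" if "n \<notin> {..<n0}" for n using that by (auto simp: g_def)
    then show ?case by (intro summable_finite[of "{..<n0}"]) auto
  qed
  define x where "x t = (\<Sum>n. g n t)" for t
  have ix: "integrable leb_I x"
    unfolding x_def
  proof (rule integrable_suminf[OF g_int])
    show "AE t in leb_I. summable (\<lambda>n. norm (g n t))" using g_summable g_nonneg by simp
    have "(LINT t|leb_I. norm (g n t)) = 1 * (1 / 2) ^ n" for n
    proof -
      have "(LINT t|leb_I. norm (g n t)) = c n * measure leb_I (F n)"
        using g_nonneg integral_indicator_leb_I[OF Fm] unfolding g_def by (simp del: Bochner_Integration.integral_indicator)
      also have "\<dots> = (1 / 2) ^ n" using \<alpha>[of n] \<gamma>(1)[of n] by (simp add: F_measure c_def f_def)
      finally show ?thesis by simp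
    qed
    then show "summable (\<lambda>n. LINT t|leb_I. norm (g n t))" using geom[of 1] by (simp only:)
  qed
  have x_distr: "distr_fun x u \<le> \<alpha> n / (2 * (real n + 1))" if u: "u \<ge> T n" for n u
  proof -
    have "distr_fun x u \<le> measure leb_I (\<Union>m. F (m + n))"
      unfolding distr_fun_def
    proof (intro leb_I.finite_measure_mono subsetI)
      fix t assume t: "t \<in> {t\<in>I. \<bar>x t\<bar> > u}"
      show "t \<in> (\<Union>m. F (m + n))"
      proof (rule ccontr)
        assume "t \<notin> (\<Union>m. F (m + n))"
        then have nF: "t \<notin> F m" if "m \<ge> n" for m using that by (metis UN_I UNIV_I le_add_diff_inverse2)
        have "x t = (\<Sum>m<n. g m t)"
          unfolding x_def by (rule suminf_finite) (use nF in \<open>auto simp: g_def\<close>)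
        moreover have "(\<Sum>m<n. g m t) \<le> T n"
          unfolding T_sum using c by (intro sum_mono) (auto simp: g_def indicator_def intro: less_imp_le)
        moreover have "(\<Sum>m<n. g m t) \<ge> 0" by (intro sum_nonneg g_nonneg)
        ultimately show False using t u by auto
      qed
    qed measurable
    also have "\<dots> \<le> (\<Sum>m. measure leb_I (F (m + n)))"
      by (rule leb_I.finite_measure_subadditive_countably) (use F_summable in auto)
    also have "\<dots> \<le> (\<Sum>m. \<alpha> n / (4 * (real n + 1)) * (1 / 2) ^ m)"
      by (intro suminf_le F_tail F_summable geom)
    also have "\<dots> = \<alpha> n / (4 * (real n + 1)) * 2"
      by (subst suminf_mult) (auto simp: suminf_geometric)
    also have "\<dots> = \<alpha> n / (2 * (real n + 1))" by (simp add: field_simps)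
    finally show ?thesis .
  qed
  define v where "v = real_cond_exp leb_I (sigma I \<A>) x"
  have v_ge: "AE t in leb_I. t \<in> A n \<longrightarrow> f n \<le> v t" for n
  proof -
    have "AE t in leb_I. g n t \<le> x t"
      using g_summable
    proof eventually_elim
      case (elim t)
      have "(\<Sum>m\<in>{n}. g m t) \<le> (\<Sum>m. g m t)" by (intro sum_le_suminf elim) (auto simp: g_nonneg)
      then show ?case by (simp add: x_def)
    qed
    then have 1: "AE t in leb_I. real_cond_exp leb_I (sigma I \<A>) (g n) t \<le> v t"
      unfolding v_def by (rule real_cond_exp_mono[OF _ g_int ix])
    have 2: "AE t in leb_I. real_cond_exp leb_I (sigma I \<A>) (g n) t =
        c n * real_cond_exp leb_I (sigma I \<A>) (indicator (F n)) t"
      unfolding g_def by (rule real_cond_exp_cmult[OF integrable_indicator_leb_I[OF Fm]])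
    have 3: "AE t in leb_I. real_cond_exp leb_I (sigma I \<A>) (indicator (F n)) t = \<gamma> n * indicator (A n) t"
      unfolding F_def \<gamma>_def by (rule cond_exp_indicator_independent[OF \<A> Gm A indep[OF _ G(1)]])
    from 1 2 3 show ?thesis
    proof eventually_elim
      case (elim t)
      then show ?case using \<gamma>(1)[of n] by (auto simp: c_def)
    qed
  qed
  have "x \<in> dilation_ideal x" using ix by (intro mem_dilation_ideal_self) (simp add: L1_def)
  then have "v \<in> dilation_ideal x"
    using univ symmetric_ideal_dilation_ideal[of x] by (simp add: universal_def averages_def v_def)
  then obtain N where N: "\<And>u. u \<ge> 1 \<Longrightarrow> distr_fun v (real N * u) \<le> real N * distr_fun x u"
    by (auto simp: dilation_ideal_def)
  \<comment> \<open>The constant \<open>N\<close> doubles as the index at which domination fails.\<close>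
  define u where "u = max 1 (T N)"
  have "\<alpha> N \<le> distr_fun v (real N * u)"
    unfolding \<alpha>_def distr_fun_def
  proof (rule leb_I.finite_measure_mono_AE)
    show "AE t in leb_I. t \<in> A N \<longrightarrow> t \<in> {t\<in>I. \<bar>v t\<bar> > real N * u}"
      using v_ge[of N] AE_space[of leb_I]
    proof eventually_elim
      case (elim t)
      then show ?case using f_large[of N] by (auto simp: u_def)
    qed
    show "{t\<in>I. \<bar>v t\<bar> > real N * u} \<in> sets leb_I" by (rule sets_superlevel) (simp add: v_def)
  qed
  also have "\<dots> \<le> real N * distr_fun x u" by (rule N) (simp add: u_def)
  also have "\<dots> \<le> real N * (\<alpha> N / (2 * (real N + 1)))"
    by (intro mult_left_mono x_distr) (auto simp: u_def)
  also have "\<dots> < \<alpha> N" using \<alpha>[of N] by (simp add: field_simps add_nonneg_pos)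
  finally show False by simp
qed

section \<open>Universal complemented sub-\<open>\<sigma>\<close>-algebras\<close>

lemma independent_complement_sym:
  "independent_complement \<A> \<B> \<Longrightarrow> independent_complement \<B> \<A>"
  unfolding independent_complement_def by (metis Int_commute Un_commute mult.commute)

theorem corollary8p6:
  fixes \<A> :: "real set set"
  assumes "sigma_subalgebra \<A>" and "complemented \<A>"
  shows "universal \<A> \<longleftrightarrow>
    finite_partition \<A> \<or> (\<exists>\<P>. finite_partition \<P> \<and> independent_complement \<P> \<A>)"
proof
  assume univ: "universal \<A>"
  obtain \<B> where ind: "independent_complement \<A> \<B>" using assms(2) by (auto simp: complemented_def)
  then have \<B>: "sigma_subalgebra \<B>"
    and indep: "\<And>D G. D \<in> \<A> \<Longrightarrow> G \<in> \<B> \<Longrightarrow> measure leb_I (D \<inter> G) = measure leb_I D * measure leb_I G"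
    by (auto simp: independent_complement_def)
  have small: "\<exists>D\<in>\<C>. 0 < measure leb_I D \<and> measure leb_I D < e"
    if "sigma_subalgebra \<C>" "\<not> finite_partition \<C>" "e > 0" for \<C> e
    using finite_partition_if_no_small_sets[OF that(1,3)] that(2) by (meson not_le)
  show "finite_partition \<A> \<or> (\<exists>\<P>. finite_partition \<P> \<and> independent_complement \<P> \<A>)"
  proof (cases "finite_partition \<B>")
    case True
    then show ?thesis using independent_complement_sym[OF ind] by blast
  next
    case False
    then show ?thesis
      using not_universal_small_sets[OF assms(1) \<B> indep small[OF assms(1)] small[OF \<B> False]] univ
      by blast
  qed
next
  assume "finite_partition \<A> \<or> (\<exists>\<P>. finite_partition \<P> \<and> independent_complement \<P> \<A>)"
  then show "universal \<A>"
    using universal_finite_partition[OF assms(1)] universal_complement by blast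
qed

end
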